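(* Let $\mathcal{H}$ be an infinite-dimensional separable complex Hilbert space and let $T$ be a bounded linear operator on $\mathcal{H}$ that is tridiagonal with respect to some orthonormal basis $\mathcal{E}=\{e_n\}_{n\in\mathbb{N}}$ of $\mathcal{H}$. Assume that $T$ is hyponormal. Then $T$ is normal if and only if $T$ is quasitriangular.
   Context: A bounded operator $T$ is hyponormal if $[T^*,T]=T^*T-TT^*$ is positive semi-definite. $T$ is tridiagonal with respect to an (ordered) orthonormal basis $\{e_n\}_{n\in\mathbb{N}}$ if $\langle T e_n,e_m\rangle=0$ whenever $|m-n|\geq 2$. $T$ is quasitriangular if there exists an increasing sequence $(P_n)_{n\geq 1}$ of finite-rank (orthogonal) projections converging strongly to the identity such that $\|TP_n-P_nTP_n\|\to 0$ as $n\to\infty$. *)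

theory Defs
  imports "HOL-Analysis.Analysis"
begin

section \<open>Complex Hilbert spaces\<close>

text \<open>
  The complex structure is added on top of the library class \<open>real_inner\<close>, whose norm and
  metric are kept: the real inner product is required to be the real part of the complex one, so
  that \<open>norm x ^ 2 = Re (cinner x x)\<close>.  The complex inner product is linear in its first and
  conjugate-linear in its second argument.
\<close>

class complex_inner = real_inner +
  fixes scaleC :: "complex \<Rightarrow> 'a \<Rightarrow> 'a"  (infixr \<open>*\<^sub>C\<close> 75)
    and cinner :: "'a \<Rightarrow> 'a \<Rightarrow> complex"
  assumes scaleC_add_right: "a *\<^sub>C (x + y) = a *\<^sub>C x + a *\<^sub>C y"
    and scaleC_add_left: "(a + b) *\<^sub>C x = a *\<^sub>C x + b *\<^sub>C x"
    and scaleC_scaleC: "a *\<^sub>C (b *\<^sub>C x) = (a * b) *\<^sub>C x"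
    and scaleR_scaleC: "scaleR r x = complex_of_real r *\<^sub>C x"
    and cinner_commute: "cinner x y = cnj (cinner y x)"
    and cinner_add_left: "cinner (x + y) z = cinner x z + cinner y z"
    and cinner_scaleC_left: "cinner (a *\<^sub>C x) y = a * cinner x y"
    and inner_eq_Re_cinner: "inner x y = Re (cinner x y)"

class complex_hilbert_space = complex_inner + complete_space

subclass (in complex_hilbert_space) banach ..

lemma scaleC_one: "1 *\<^sub>C x = (x :: 'a :: complex_inner)"
  using scaleR_scaleC[of 1 x] by simp

global_interpretation complex_vec: vector_space "scaleC :: complex \<Rightarrow> 'a \<Rightarrow> 'a :: complex_inner"
  defines cspan = complex_vec.span
  by unfold_locales (simp_all add: scaleC_add_right scaleC_add_left scaleC_scaleC scaleC_one)

definition finite_cdim :: "'a :: complex_inner set \<Rightarrow> bool"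
  where "finite_cdim V \<longleftrightarrow> (\<exists>B. finite B \<and> cspan B = V)"

definition orthonormal_basis :: "(nat \<Rightarrow> 'a :: complex_inner) \<Rightarrow> bool"
  where "orthonormal_basis e \<longleftrightarrow>
    (\<forall>m n. cinner (e m) (e n) = (if m = n then 1 else 0)) \<and> closure (cspan (range e)) = UNIV"


section \<open>Bounded operators\<close>

definition bounded_clinear :: "('a :: complex_inner \<Rightarrow> 'b :: complex_inner) \<Rightarrow> bool"
  where "bounded_clinear T \<longleftrightarrow> bounded_linear T \<and> (\<forall>c x. T (c *\<^sub>C x) = c *\<^sub>C T x)"

definition cadjoint :: "('a :: complex_hilbert_space \<Rightarrow> 'a) \<Rightarrow> 'a \<Rightarrow> 'a"
  where "cadjoint T = (THE S. \<forall>x y. cinner (T x) y = cinner x (S y))"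

definition positive_semidefinite :: "('a :: complex_inner \<Rightarrow> 'a) \<Rightarrow> bool"
  where "positive_semidefinite A \<longleftrightarrow> (\<forall>x. cinner (A x) x \<in> \<real> \<and> 0 \<le> Re (cinner (A x) x))"

definition commutator :: "('a :: complex_inner \<Rightarrow> 'a) \<Rightarrow> ('a \<Rightarrow> 'a) \<Rightarrow> 'a \<Rightarrow> 'a"
  where "commutator S T = (\<lambda>x. S (T x) - T (S x))"

definition normal_operator :: "('a :: complex_hilbert_space \<Rightarrow> 'a) \<Rightarrow> bool"
  where "normal_operator T \<longleftrightarrow> cadjoint T \<circ> T = T \<circ> cadjoint T"

definition hyponormal :: "('a :: complex_hilbert_space \<Rightarrow> 'a) \<Rightarrow> bool"
  where "hyponormal T \<longleftrightarrow> positive_semidefinite (commutator (cadjoint T) T)"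

definition tridiagonal :: "(nat \<Rightarrow> 'a :: complex_inner) \<Rightarrow> ('a \<Rightarrow> 'a) \<Rightarrow> bool"
  where "tridiagonal e T \<longleftrightarrow> (\<forall>m n. 2 \<le> \<bar>int m - int n\<bar> \<longrightarrow> cinner (T (e n)) (e m) = 0)"

definition orthogonal_projection :: "('a :: complex_hilbert_space \<Rightarrow> 'a) \<Rightarrow> bool"
  where "orthogonal_projection P \<longleftrightarrow> bounded_clinear P \<and> P \<circ> P = P \<and> cadjoint P = P"

text \<open>
  ``Increasing'' refers to the (non-strict) usual order of self-adjoint operators.
  The sequence is indexed from \<open>0\<close>.
\<close>

definition quasitriangular :: "('a :: complex_hilbert_space \<Rightarrow> 'a) \<Rightarrow> bool"
  where "quasitriangular T \<longleftrightarrow>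
    (\<exists>P :: nat \<Rightarrow> 'a \<Rightarrow> 'a.
       (\<forall>n. orthogonal_projection (P n) \<and> finite_cdim (range (P n))) \<and>
       (\<forall>n. positive_semidefinite (\<lambda>x. P (Suc n) x - P n x)) \<and>
       (\<forall>x. (\<lambda>n. P n x) \<longlonglongrightarrow> x) \<and>
       (\<lambda>n. onorm (\<lambda>x. T (P n x) - P n (T (P n x)))) \<longlonglongrightarrow> 0)"


section \<open>Existence of the adjoint\<close>

lemma riesz_real:
  fixes f :: "'a :: complex_hilbert_space \<Rightarrow> real"
  assumes "bounded_linear f"
  shows "\<exists>w. \<forall>x. f x = inner x w"
proof -
  interpret f: bounded_linear f by fact
  obtain K where K: "\<And>x. norm (f x) \<le> norm x * K" using f.bounded by blast
  define J where "J x = inner x x - 2 * f x" for x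
  have lb: "- (K^2) \<le> J x" for x
  proof -
    have "f x \<le> norm x * K" using K[of x] by simp
    moreover have "0 \<le> (norm x - K)^2" by simp
    ultimately show ?thesis
      unfolding J_def by (simp add: power2_norm_eq_inner[symmetric] power2_diff)
  qed
  define m where "m = Inf (range J)"
  have bdd: "bdd_below (range J)" using lb by (auto intro!: bdd_belowI)
  have m_le: "m \<le> J x" for x unfolding m_def using bdd by (simp add: cInf_lower)
  have "\<exists>x. J x < m + e" if "e > 0" for e
    using cInf_lessD[of "range J" "m + e"] that unfolding m_def by auto
  then have "\<forall>n. \<exists>x. J x < m + 1 / real (Suc n)" by simp
  then obtain X where X: "\<And>n. J (X n) < m + 1 / real (Suc n)" by metis
  have par: "(norm (x - y))^2 = 2 * J x + 2 * J y - 4 * J ((1/2) *\<^sub>R (x + y))" for x y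
    unfolding J_def
    by (simp add: power2_norm_eq_inner inner_add inner_diff inner_commute f.add f.scaleR algebra_simps)
  have "Cauchy X"
  proof (rule metric_CauchyI)
    fix e :: real assume e: "e > 0"
    obtain N where N: "1 / real (Suc N) < e^2 / 4"
      using nat_approx_posE[of "e^2/4"] e by auto
    have "dist (X a) (X b) < e" if "a \<ge> N" "b \<ge> N" for a b
    proof -
      have s: "1 / real (Suc k) \<le> 1 / real (Suc N)" if "k \<ge> N" for k
        using that by (intro divide_left_mono) auto
      have "(norm (X a - X b))^2 \<le> 2 * J (X a) + 2 * J (X b) - 4 * m"
        using par[of "X a" "X b"] m_le[of "(1/2) *\<^sub>R (X a + X b)"] by linarith
      also have "\<dots> < e^2"
        using X[of a] X[of b] s[OF that(1)] s[OF that(2)] N by linarith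
      finally show ?thesis
        using e by (simp add: dist_norm power_less_imp_less_base)
    qed
    then show "\<exists>M. \<forall>m\<ge>M. \<forall>n\<ge>M. dist (X m) (X n) < e" by blast
  qed
  then obtain w where w: "X \<longlonglongrightarrow> w" using Cauchy_convergent convergent_def by blast
  have "(\<lambda>n. J (X n)) \<longlonglongrightarrow> J w"
    unfolding J_def by (intro tendsto_intros w f.tendsto)
  moreover have "(\<lambda>n. m + 1 / real (Suc n)) \<longlonglongrightarrow> m + 0"
    by (intro tendsto_add tendsto_const LIMSEQ_Suc[OF lim_1_over_n])
  ultimately have Jw: "J w \<le> m"
    using X by (intro LIMSEQ_le[of _ "J w" _ m]) (auto intro: less_imp_le)
  have "f x = inner x w" for x
  proof -
    define d where "d = f x - inner x w"
    have ineq: "2 * t * d \<le> t^2 * inner x x" for t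
    proof -
      have "J w \<le> J (w + t *\<^sub>R x)" using Jw m_le[of "w + t *\<^sub>R x"] by linarith
      then show ?thesis
        unfolding J_def d_def
        by (simp add: f.add f.scaleR inner_add inner_commute algebra_simps power2_eq_square)
    qed
    have "d = 0"
    proof (rule ccontr)
      assume d: "d \<noteq> 0"
      define c where "c = inner x x + 1"
      have c: "c > 0" "inner x x < c" by (auto simp: c_def add_nonneg_pos)
      have "2 * (d / c) * d \<le> (d / c)^2 * inner x x" by (rule ineq)
      also have "\<dots> \<le> (d / c)^2 * c" using c by (intro mult_left_mono) auto
      also have "\<dots> = (d / c) * d" using c by (simp add: power2_eq_square)
      finally have "d * d / c \<le> 0" by simp
      moreover have "d * d / c > 0" using c(1) d by (metis not_real_square_gt_zero divide_pos_pos)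
      ultimately show False by linarith
    qed
    then show ?thesis by (simp add: d_def)
  qed
  then show ?thesis by blast
qed

lemma cinner_eqI:
  fixes a b :: "'a :: complex_inner"
  assumes "\<And>x. cinner x a = cinner x b"
  shows "a = b"
proof -
  have "inner x a = inner x b" for x using assms by (simp add: inner_eq_Re_cinner)
  then have "inner (a - b) (a - b) = 0" by (simp add: inner_diff_right)
  then show ?thesis by simp
qed

lemma cadjoint_works:
  fixes T :: "'a :: complex_hilbert_space \<Rightarrow> 'a"
  assumes "bounded_clinear T"
  shows "cinner (T x) y = cinner x (cadjoint T y)"
proof -
  have bl: "bounded_linear T" and sc: "\<And>c x. T (c *\<^sub>C x) = c *\<^sub>C T x"
    using assms by (auto simp: bounded_clinear_def)
  have "\<exists>w. \<forall>x. cinner (T x) y = cinner x w" for y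
  proof -
    have "bounded_linear (\<lambda>x. inner (T x) y)"
      using bounded_linear_compose[OF bounded_linear_inner_left bl] by (simp add: o_def)
    then obtain w where w: "\<And>x. inner (T x) y = inner x w" using riesz_real by blast
    have "cinner (T x) y = cinner x w" for x
      using w[of x] w[of "(- \<i>) *\<^sub>C x"]
      by (simp add: inner_eq_Re_cinner sc cinner_scaleC_left complex_eq_iff del: complex_vec.scale_minus_left)
    then show ?thesis by blast
  qed
  then obtain S where S: "\<forall>x y. cinner (T x) y = cinner x (S y)" by metis
  have "\<forall>x y. cinner (T x) y = cinner x (cadjoint T y)"
    unfolding cadjoint_def
  proof (rule theI[of _ S])
    fix R assume "\<forall>x y. cinner (T x) y = cinner x (R y)"
    then show "R = S" using S by (intro ext cinner_eqI) metis
  qed (rule S)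
  then show ?thesis by blast
qed

end

theory Submission
  imports Defs
begin

text \<open>
  For a normal \<open>T\<close>, spectral projections of the commuting operators \<open>Re T\<close> and \<open>Im T\<close> split every finite
  set of vectors into pieces that are almost eigenvectors of \<open>T\<close>, so it lies in a finite-dimensional
  almost invariant subspace.

  Conversely, let \<open>T\<close> be tridiagonal and hyponormal with lower, diagonal and upper entries \<open>l n\<close>, \<open>b n\<close>,
  \<open>u n\<close>, and let \<open>d n\<close> be the diagonal entries of \<open>D = T* T - T T*\<close>.  The partial sums of \<open>d\<close> telescope to
  \<open>|l n|^2 - |u n|^2\<close>, so \<open>D\<close> is of trace class, and positivity bounds its off-diagonal entries by the \<open>d n\<close>.
  If \<open>T\<close> is not normal, \<open>|l n| - |u n|\<close> is eventually bounded away from 0, and these bounds make the sequences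
  \<open>b n\<close>, \<open>|l n|\<close> and \<open>|u n|\<close> converge, with \<open>lim |u n| < lim |l n|\<close>.
  Hence, for \<open>b = lim b n\<close>, \<open>T - b\<close> is up to a small and a finite-rank operator bounded below with an adjoint
  that is not bounded below, which is impossible for a quasitriangular operator.
\<close>

section \<open>Spectral projections of symmetric operators\<close>

text \<open>Spectral projections are needed only for a finite bisection of an interval. One cut of a
  symmetric operator at a real value is enough, provided that the cut commutes with everything that
  commutes with the operator: this lets the cuts for \<open>Re T\<close> and \<open>Im T\<close>
  refine each other, and it keeps their ranges complex subspaces although symmetry refers to the
  real inner product.

  The converse is an index obstruction. When the lower weights dominate, the tail of
  \<open>T - b\<close> behaves like a weighted forward shift, which has index -1; a quasitriangular
  operator almost preserves large finite-dimensional subspaces, on which injectivity forces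
  surjectivity. A single scalar \<open>b\<close> has to approximate the whole tail of the diagonal,
  so boundedness of the entries would not suffice and their convergence must be extracted from
  summability of the self-commutator entries.\<close>

definition symmetric_op :: "('a::real_inner \<Rightarrow> 'a) \<Rightarrow> bool"
  where "symmetric_op A \<longleftrightarrow> bounded_linear A \<and> (\<forall>x y. inner (A x) y = inner x (A y))"

definition nonneg_op :: "('a::real_inner \<Rightarrow> 'a) \<Rightarrow> bool"
  where "nonneg_op A \<longleftrightarrow> (\<forall>x. 0 \<le> inner (A x) x)"

definition commute :: "('a \<Rightarrow> 'a) \<Rightarrow> ('a \<Rightarrow> 'a) \<Rightarrow> bool"
  where "commute A B \<longleftrightarrow> (\<forall>x. A (B x) = B (A x))"

lemma commuteD: "commute A B \<Longrightarrow> A (B x) = B (A x)"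
  by (simp add: commute_def)

lemma commute_sym: "commute A B \<Longrightarrow> commute B A"
  by (simp add: commute_def)

lemma commute_self [simp]: "commute A A"
  by (simp add: commute_def)

lemma commute_compose: "commute A B \<Longrightarrow> commute A C \<Longrightarrow> commute A (\<lambda>x. B (C x))"
  by (simp add: commute_def)

lemma commute_diff: "bounded_linear A \<Longrightarrow> commute A B \<Longrightarrow> commute A C \<Longrightarrow> commute A (\<lambda>x. B x - C x)"
  by (simp add: commute_def linear_diff bounded_linear.linear)

lemma commute_add: "bounded_linear A \<Longrightarrow> commute A B \<Longrightarrow> commute A C \<Longrightarrow> commute A (\<lambda>x. B x + C x)"
  by (simp add: commute_def linear_add bounded_linear.linear)

lemma commute_scaleR: "bounded_linear A \<Longrightarrow> commute A B \<Longrightarrow> commute A (\<lambda>x. r *\<^sub>R B x)"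
  by (simp add: commute_def linear_scale bounded_linear.linear)

lemma commute_ident: "commute A (\<lambda>x. x)"
  by (simp add: commute_def)

lemma symmetric_opD: "symmetric_op A \<Longrightarrow> inner (A x) y = inner x (A y)"
  by (simp add: symmetric_op_def)

lemma symmetric_op_bounded_linear: "symmetric_op A \<Longrightarrow> bounded_linear A"
  by (simp add: symmetric_op_def)

lemma symmetric_op_ident: "symmetric_op (\<lambda>x. x)"
  by (simp add: symmetric_op_def)

lemma symmetric_op_compose:
  assumes "symmetric_op A" "symmetric_op B" "commute A B"
  shows "symmetric_op (\<lambda>x. A (B x))"
  using assms unfolding symmetric_op_def commute_def by (metis bounded_linear_compose)

lemma symmetric_op_diff:
  "symmetric_op A \<Longrightarrow> symmetric_op B \<Longrightarrow> symmetric_op (\<lambda>x. A x - B x)"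
  by (simp add: symmetric_op_def bounded_linear_sub inner_diff)

lemma symmetric_op_add:
  "symmetric_op A \<Longrightarrow> symmetric_op B \<Longrightarrow> symmetric_op (\<lambda>x. A x + B x)"
  by (simp add: symmetric_op_def bounded_linear_add inner_add)

lemma symmetric_op_scaleR:
  "symmetric_op A \<Longrightarrow> symmetric_op (\<lambda>x. r *\<^sub>R A x)"
  by (simp add: symmetric_op_def bounded_linear_const_scaleR)

lemma nonneg_opD: "nonneg_op A \<Longrightarrow> 0 \<le> inner (A x) x"
  by (simp add: nonneg_op_def)

text \<open>Riesz: with \<open>R 0 = B\<close> and \<open>R (k + 1) = R k - (R k)\<^sup>2\<close>, \<open>B\<close> is the strong sum of the squares of the \<open>R k\<close>.\<close>

lemma nonneg_op_compose_contraction: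
  assumes A: "symmetric_op A" "nonneg_op A"
    and B: "symmetric_op B" "nonneg_op B" "\<And>x. inner (B x) x \<le> inner x x"
    and comm: "commute A B"
  shows "nonneg_op (\<lambda>x. A (B x))"
proof -
  define R where "R = rec_nat B (\<lambda>_ R x. R x - R (R x))"
  have R0: "R 0 = B" and RS: "R (Suc k) = (\<lambda>x. R k x - R k (R k x))" for k
    by (simp_all add: R_def)
  have inv: "symmetric_op (R k) \<and> commute A (R k) \<and> nonneg_op (R k) \<and> (\<forall>x. inner (R k x) x \<le> inner x x)" for k
  proof (induction k)
    case 0
    then show ?case using B comm by (simp add: R0)
  next
    case (Suc k)
    then have s: "symmetric_op (R k)" and c: "commute A (R k)" and p: "nonneg_op (R k)"
      and u: "\<And>x. inner (R k x) x \<le> inner x x" by auto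
    have lin: "R k (x - y) = R k x - R k y" for x y
      using symmetric_op_bounded_linear[OF s] by (simp add: linear_diff bounded_linear.linear)
    have sym: "inner (R k x) y = inner x (R k y)" for x y
      using s by (rule symmetric_opD)
    have 1: "0 \<le> inner (R (Suc k) x) x" for x
    proof -
      \<comment> \<open>This and the next inequality are the two summands of R - R^2 = R^2 (1 - R) +
        R (1 - R)^2, both nonnegative by the induction hypothesis.\<close>
      have "0 \<le> inner (R k x) (R k x) - inner (R k (R k x)) (R k x)"
        using u[of "R k x"] by simp
      moreover have "0 \<le> inner (R k (x - R k x)) (x - R k x)"
        using p by (simp add: nonneg_op_def)
      ultimately show ?thesis
        by (simp add: RS lin inner_diff sym)
    qed
    have 2: "inner (R (Suc k) x) x \<le> inner x x" for x
    proof -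
      have "0 \<le> inner (R k x) (R k x)" by simp
      then show ?thesis using u[of x] by (simp add: RS inner_diff sym)
    qed
    have "symmetric_op (R (Suc k))"
      unfolding RS by (rule symmetric_op_diff[OF s symmetric_op_compose[OF s s commute_self]])
    moreover have "commute A (R (Suc k))"
      unfolding RS using symmetric_op_bounded_linear[OF A(1)] c
      by (rule commute_diff) (rule commute_compose[OF c c])
    ultimately show ?case using 1 2 by (simp add: nonneg_op_def)
  qed
  have sym: "inner (R k x) y = inner x (R k y)" and comR: "A (R k x) = R k (A x)"
    and pos: "0 \<le> inner (R k x) x" for k x y
    using inv[of k] by (blast intro: symmetric_opD commuteD nonneg_opD)+
  interpret A: bounded_linear A using A by (simp add: symmetric_op_def)
  show ?thesis
    unfolding nonneg_op_def
  proof
    fix x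
    have "(\<Sum>k<n. (norm (R k x))\<^sup>2) = inner (B x) x - inner (R n x) x" for n
      by (induction n) (simp_all add: R0 RS inner_diff power2_norm_eq_inner sym)
    then have "(\<Sum>k<n. (norm (R k x))\<^sup>2) \<le> inner (B x) x" for n
      using pos[of n x] by simp
    then have "summable (\<lambda>k. (norm (R k x))\<^sup>2)"
      by (intro bounded_imp_summable[where B = "inner (B x) x"]) (auto simp: lessThan_Suc_atMost[symmetric] simp del: sum.lessThan_Suc)
    then have "(\<lambda>k. (norm (R k x))\<^sup>2) \<longlonglongrightarrow> 0"
      by (rule summable_LIMSEQ_zero)
    then have "(\<lambda>k. norm (R k x)) \<longlonglongrightarrow> 0"
      using tendsto_real_sqrt by fastforce
    then have lim: "(\<lambda>k. R k x) \<longlonglongrightarrow> 0"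
      by (simp add: tendsto_norm_zero_iff)
    have "(\<lambda>k. inner (A (R k x)) x) \<longlonglongrightarrow> inner (A 0) x"
      by (intro tendsto_intros A.tendsto lim)
    \<comment> \<open>The form of \<open>A (R n x)\<close> drops at each step by that of
      \<open>A\<close> at \<open>R n x\<close>, which is nonnegative; as it tends to 0, its initial
      value cannot be negative.\<close>
    moreover have "inner (A (R n x)) x \<le> inner (A (B x)) x" for n
    proof (induction n)
      case (Suc n)
      have "inner (A (R (Suc n) x)) x = inner (A (R n x)) x - inner (A (R n x)) (R n x)"
        by (simp add: RS A.diff inner_diff comR sym)
      moreover have "0 \<le> inner (A (R n x)) (R n x)"
        using A by (simp add: nonneg_op_def)
      ultimately show ?case using Suc by simp
    qed (simp add: R0)
    ultimately show "0 \<le> inner (A (B x)) x"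
      by (intro LIMSEQ_le_const2[where X = "\<lambda>k. inner (A (R k x)) x"]) (auto simp: A.zero)
  qed
qed

lemma nonneg_op_compose:
  assumes A: "symmetric_op A" "nonneg_op A"
    and B: "symmetric_op B" "nonneg_op B"
    and comm: "commute A B"
  shows "nonneg_op (\<lambda>x. A (B x))"
proof -
  obtain K where K: "K > 0" "\<And>x. norm (B x) \<le> norm x * K"
    using bounded_linear.pos_bounded[OF symmetric_op_bounded_linear[OF B(1)]] by blast
  have "inner ((1 / K) *\<^sub>R B x) x \<le> inner x x" for x
  proof -
    have "inner (B x) x \<le> norm (B x) * norm x" by (rule norm_cauchy_schwarz)
    also have "\<dots> \<le> norm x * K * norm x" using K(2)[of x] by (intro mult_right_mono) auto
    finally have "inner (B x) x \<le> K * inner x x"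
      by (simp add: power2_norm_eq_inner[symmetric] power2_eq_square mult_ac)
    then show ?thesis using K(1) by (simp add: field_simps)
  qed
  moreover have "nonneg_op (\<lambda>x. (1 / K) *\<^sub>R B x)"
    using B K by (simp add: nonneg_op_def)
  ultimately have "nonneg_op (\<lambda>x. A ((1 / K) *\<^sub>R B x))"
    using nonneg_op_compose_contraction[OF A symmetric_op_scaleR[OF B(1)] _ _
        commute_scaleR[OF symmetric_op_bounded_linear[OF A(1)] comm]] by blast
  moreover have "A ((1 / K) *\<^sub>R B x) = (1 / K) *\<^sub>R A (B x)" for x
    using symmetric_op_bounded_linear[OF A(1)] by (simp add: linear_scale bounded_linear.linear)
  ultimately show ?thesis using K(1) by (simp add: nonneg_op_def zero_le_divide_iff)
qed

text \<open>The Newton--Schulz iteration \<open>s \<mapsto> s (3 - s\<^sup>2) / 2\<close> for the sign function.\<close>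

primrec sign_iter :: "('a::real_inner \<Rightarrow> 'a) \<Rightarrow> nat \<Rightarrow> 'a \<Rightarrow> 'a" where
  "sign_iter A 0 = A"
| "sign_iter A (Suc n) = (\<lambda>x. (3/2) *\<^sub>R sign_iter A n x -
      (1/2) *\<^sub>R sign_iter A n (sign_iter A n (sign_iter A n x)))"

lemma sign_iter_commute:
  assumes "bounded_linear B" "commute B A"
  shows "commute B (sign_iter A n)"
proof (induction n)
  case (Suc n)
  show ?case
    unfolding sign_iter.simps
    by (rule commute_diff[OF assms(1) commute_scaleR[OF assms(1) Suc] commute_scaleR[OF assms(1)
          commute_compose[OF Suc commute_compose[OF Suc Suc]]]])
qed (simp add: assms)

lemma sign_iter_symmetric: "symmetric_op A \<Longrightarrow> symmetric_op (sign_iter A n)"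
proof (induction n)
  case (Suc n)
  then have s: "symmetric_op (sign_iter A n)" by simp
  have "symmetric_op (\<lambda>x. sign_iter A n (sign_iter A n (sign_iter A n x)))"
    by (rule symmetric_op_compose[OF s symmetric_op_compose[OF s s]]) (simp_all add: commute_def)
  then show ?case
    unfolding sign_iter.simps by (intro symmetric_op_diff symmetric_op_scaleR s)
qed simp

lemma sign_iter_commute_iter:
  assumes "symmetric_op A"
  shows "commute (sign_iter A m) (sign_iter A n)"
  by (meson assms commute_self commute_sym sign_iter_commute sign_iter_symmetric symmetric_op_bounded_linear)

text \<open>For f(s) = s (3 - s^2) / 2 one has 1 - f(s)^2 = (1 - s^2)^2 (4 - s^2) / 4. This is the
  form of 4 - s^2 at \<open>?z\<close>, up to the factor 4.\<close>

lemma sign_iter_contraction: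
  assumes "symmetric_op A" "\<And>x. norm (A x) \<le> norm x"
  shows "norm (sign_iter A n x) \<le> norm x"
proof (induction n arbitrary: x)
  case (Suc n)
  let ?s = "sign_iter A n"
  have s: "symmetric_op ?s" by (rule sign_iter_symmetric[OF assms(1)])
  interpret s: bounded_linear ?s using s by (rule symmetric_op_bounded_linear)
  have sym: "inner (?s x) y = inner x (?s y)" for x y using s by (rule symmetric_opD)
  have le: "inner (?s x) (?s x) \<le> inner x x" for x
    using Suc[of x] by (simp add: norm_le_square power2_norm_eq_inner norm_le)
  let ?z = "x - ?s (?s x)"
  have "0 \<le> 4 * inner ?z ?z - inner (?s ?z) (?s ?z)"
    using le[of ?z] inner_ge_zero[of ?z] by linarith
  then have "inner (sign_iter A (Suc n) x) (sign_iter A (Suc n) x) \<le> inner x x"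
    by (simp add: s.diff s.scaleR inner_diff sym inner_commute algebra_simps)
  then show ?case by (simp add: norm_le)
qed (simp add: assms)

text \<open>Consecutive products differ by s_n s_k (1 - s_k^2) / 2, a product of commuting
  nonnegative operators. So s_n s_m grows with m from its value s_n^2 at m = n: all iterates have
  the same sign and move away from 0.\<close>

lemma sign_iter_monotone:
  assumes "symmetric_op A" "\<And>x. norm (A x) \<le> norm x" "n \<le> m"
  shows "nonneg_op (\<lambda>x. sign_iter A n (sign_iter A m x))"
    and "(norm (sign_iter A n x))\<^sup>2 \<le> inner (sign_iter A n (sign_iter A m x)) x"
proof -
  let ?s = "sign_iter A"
  have s: "symmetric_op (?s k)" for k by (rule sign_iter_symmetric[OF assms(1)])
  have c: "commute (?s j) (?s k)" for j k by (rule sign_iter_commute_iter[OF assms(1)])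
  have sym: "inner (?s k x) y = inner x (?s k y)" for k x y using s by (rule symmetric_opD)
  have bl: "bounded_linear (?s k)" for k using s by (rule symmetric_op_bounded_linear)
  have lin: "?s k (x - y) = ?s k x - ?s k y" "?s k (r *\<^sub>R x) = r *\<^sub>R ?s k x" for k x y r
    using bl[of k] by (simp_all add: linear_diff linear_scale bounded_linear.linear)
  have "nonneg_op (\<lambda>x. ?s n (?s m x)) \<and> (\<forall>x. (norm (?s n x))\<^sup>2 \<le> inner (?s n (?s m x)) x)"
    using assms(3)
  proof (induction m rule: dec_induct)
    case base
    have "inner (?s n (?s n x)) x = (norm (?s n x))\<^sup>2" for x
      by (subst sym) (simp add: power2_norm_eq_inner)
    then show ?case by (simp add: nonneg_op_def)
  next
    case (step k)
    have s2: "symmetric_op (\<lambda>x. ?s k (?s k x))" by (rule symmetric_op_compose[OF s s c])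
    have "nonneg_op (\<lambda>x. ?s n (?s k (x - ?s k (?s k x))))"
    proof (rule nonneg_op_compose[where A = "\<lambda>x. ?s n (?s k x)" and B = "\<lambda>x. x - ?s k (?s k x)"])
      show "nonneg_op (\<lambda>x. x - ?s k (?s k x))"
        using sign_iter_contraction[OF assms(1,2), of k]
        by (auto simp: nonneg_op_def inner_diff sym norm_le)
      show "commute (\<lambda>x. ?s n (?s k x)) (\<lambda>x. x - ?s k (?s k x))"
        using c[of n k] by (simp add: commute_def lin)
      show "symmetric_op (\<lambda>x. ?s n (?s k x))" by (rule symmetric_op_compose[OF s s c])
      show "symmetric_op (\<lambda>x. x - ?s k (?s k x))" by (rule symmetric_op_diff[OF symmetric_op_ident s2])
    qed (use step in simp)
    then have "0 \<le> inner (?s n (?s k x)) x - inner (?s n (?s k (?s k (?s k x)))) x" for x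
      by (simp add: nonneg_op_def lin inner_diff)
    moreover have "inner (?s n (?s (Suc k) x)) x = inner (?s n (?s k x)) x
        + (1/2) * (inner (?s n (?s k x)) x - inner (?s n (?s k (?s k (?s k x)))) x)" for x
      by (simp add: lin inner_diff algebra_simps)
    ultimately have mono: "inner (?s n (?s k x)) x \<le> inner (?s n (?s (Suc k) x)) x" for x
      by (simp only:) (simp add: field_simps del: sign_iter.simps)
    then have "(norm (?s n x))\<^sup>2 \<le> inner (?s n (?s (Suc k) x)) x"
      "0 \<le> inner (?s n (?s (Suc k) x)) x" for x
      using step.IH order_trans[OF _ mono] nonneg_opD by blast+
    then show ?case by (simp only: nonneg_op_def simp_thms)
  qed
  then show "nonneg_op (\<lambda>x. ?s n (?s m x))"
    and "(norm (?s n x))\<^sup>2 \<le> inner (?s n (?s m x)) x" by auto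
qed

text \<open>In the expanded square the mixed term is bounded below by s_n^2. The iterates are
  thereby controlled by a bounded increasing real sequence, which makes them Cauchy.\<close>

lemma sign_iter_diff:
  assumes "symmetric_op A" "\<And>x. norm (A x) \<le> norm x" "n \<le> m"
  shows "(norm (sign_iter A m x - sign_iter A n x))\<^sup>2 \<le> (norm (sign_iter A m x))\<^sup>2 - (norm (sign_iter A n x))\<^sup>2"
  using sign_iter_monotone(2)[OF assms, of x] symmetric_opD[OF sign_iter_symmetric[OF assms(1)], of n "sign_iter A m x" x]
  by (simp add: power2_norm_eq_inner inner_diff inner_commute)

lemma sign_iter_convergent:
  fixes A :: "'a::{real_inner, complete_space} \<Rightarrow> 'a"
  assumes "symmetric_op A" "\<And>x. norm (A x) \<le> norm x"
  shows "convergent (\<lambda>n. sign_iter A n x)"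
proof -
  let ?q = "\<lambda>n. (norm (sign_iter A n x))\<^sup>2"
  have d: "(norm (sign_iter A m x - sign_iter A n x))\<^sup>2 \<le> ?q m - ?q n" if "n \<le> m" for n m
    using assms that by (rule sign_iter_diff)
  have "incseq ?q"
    unfolding incseq_def using d by (smt (verit) zero_le_power2)
  moreover have "?q n \<le> (norm x)\<^sup>2" for n
    using sign_iter_contraction[OF assms] by (intro power_mono) auto
  ultimately obtain L where "?q \<longlonglongrightarrow> L" using incseq_convergent by blast
  then have C: "Cauchy ?q" using LIMSEQ_imp_Cauchy by blast
  have "Cauchy (\<lambda>n. sign_iter A n x)"
  proof (rule metric_CauchyI)
    fix r :: real assume "0 < r"
    then obtain M where M: "\<And>m n. m \<ge> M \<Longrightarrow> n \<ge> M \<Longrightarrow> dist (?q m) (?q n) < r\<^sup>2"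
      using metric_CauchyD[OF C, of "r\<^sup>2"] by auto
    have *: "dist (sign_iter A m x) (sign_iter A n x) < r" if "M \<le> n" "n \<le> m" for m n
      using d[OF that(2)] M[of m n] that \<open>0 < r\<close>
      by (simp add: dist_norm) (smt (verit) power_mono)
    have "dist (sign_iter A m x) (sign_iter A n x) < r" if "M \<le> m" "M \<le> n" for m n
      using *[of n m] *[of m n] that by (metis dist_commute nle_le)
    then show "\<exists>M. \<forall>m\<ge>M. \<forall>n\<ge>M. dist (sign_iter A m x) (sign_iter A n x) < r" by blast
  qed
  then show ?thesis by (rule Cauchy_convergent)
qed

text \<open>The strong limit \<open>s\<close> of the iterates satisfies s^3 = s and plays the role
  of sgn(A); \<open>E\<close> = (s^2 + s) / 2 projects onto its eigenspace for 1, where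
  \<open>A\<close> agrees with the nonnegative operator \<open>A s\<close>.\<close>

lemma spectral_cut_contraction:
  fixes A :: "'a::{real_inner, complete_space} \<Rightarrow> 'a"
  assumes A: "symmetric_op A" "\<And>x. norm (A x) \<le> norm x"
  obtains E where "symmetric_op E" "\<And>x. E (E x) = E x"
    "\<And>B. bounded_linear B \<Longrightarrow> commute B A \<Longrightarrow> commute B E"
    "\<And>x. E x = x \<Longrightarrow> 0 \<le> inner (A x) x" "\<And>x. E x = 0 \<Longrightarrow> inner (A x) x \<le> 0"
proof -
  let ?s = "sign_iter A"
  define s where "s x = lim (\<lambda>n. ?s n x)" for x
  have lim: "(\<lambda>n. ?s n x) \<longlonglongrightarrow> s x" for x
    unfolding s_def using sign_iter_convergent[OF A] convergent_LIMSEQ_iff by blast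
  have symn: "symmetric_op (?s k)" for k by (rule sign_iter_symmetric[OF A(1)])
  have bln: "bounded_linear (?s k)" for k using symn by (rule symmetric_op_bounded_linear)
  have norms: "norm (s x) \<le> norm x" for x
    using tendsto_norm[OF lim[of x]] sign_iter_contraction[OF A]
    by (intro LIMSEQ_le_const2[where X = "\<lambda>n. norm (?s n x)"]) auto
  have bl: "bounded_linear s"
  proof (rule bounded_linear_intro[where K = 1])
    fix x y and r :: real
    have "(\<lambda>n. ?s n (x + y)) \<longlonglongrightarrow> s x + s y"
      using tendsto_add[OF lim[of x] lim[of y]] bln by (simp add: linear_add bounded_linear.linear)
    then show "s (x + y) = s x + s y" using lim LIMSEQ_unique by blast
    have "(\<lambda>n. ?s n (r *\<^sub>R x)) \<longlonglongrightarrow> r *\<^sub>R s x"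
      using tendsto_scaleR[OF tendsto_const lim[of x], of r] bln by (simp add: linear_scale bounded_linear.linear)
    then show "s (r *\<^sub>R x) = r *\<^sub>R s x" using lim LIMSEQ_unique by blast
  qed (simp add: norms)
  interpret s: bounded_linear s by (rule bl)
  have sym: "inner (s x) y = inner x (s y)" for x y
  proof -
    have "(\<lambda>n. inner (?s n x) y) \<longlonglongrightarrow> inner (s x) y" by (intro tendsto_intros lim)
    moreover have "(\<lambda>n. inner (?s n x) y) \<longlonglongrightarrow> inner x (s y)"
      unfolding symmetric_opD[OF symn] by (intro tendsto_intros lim)
    ultimately show ?thesis using LIMSEQ_unique by blast
  qed
  have com: "commute B s" if "bounded_linear B" "commute B A" for B
    unfolding commute_def
  proof
    fix x
    have "(\<lambda>n. B (?s n x)) \<longlonglongrightarrow> B (s x)"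
      using that(1) lim by (rule bounded_linear.tendsto)
    moreover have "(\<lambda>n. B (?s n x)) \<longlonglongrightarrow> s (B x)"
      using lim[of "B x"] commuteD[OF sign_iter_commute[OF that]] by simp
    ultimately show "B (s x) = s (B x)" using LIMSEQ_unique by blast
  qed
  \<comment> \<open>Strong limits may be composed here because the iterates are uniformly
    contractive.\<close>
  have iter_lim: "(\<lambda>n. ?s n (y n)) \<longlonglongrightarrow> s z" if "y \<longlonglongrightarrow> z" for y z
  proof -
    have "(\<lambda>n. y n - z) \<longlonglongrightarrow> 0" using that LIM_zero by blast
    then have "(\<lambda>n. ?s n (y n - z)) \<longlonglongrightarrow> 0"
      by (rule Lim_null_comparison[rotated, OF tendsto_norm_zero])
        (simp add: sign_iter_contraction[OF A])
    then have "(\<lambda>n. ?s n (y n - z) + ?s n z) \<longlonglongrightarrow> 0 + s z" by (intro tendsto_add lim)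
    then show ?thesis using bln by (simp add: linear_diff bounded_linear.linear)
  qed
  have s3: "s (s (s x)) = s x" for x
  proof -
    have "(\<lambda>n. (3/2) *\<^sub>R ?s n x - (1/2) *\<^sub>R ?s n (?s n (?s n x))) \<longlonglongrightarrow> (3/2) *\<^sub>R s x - (1/2) *\<^sub>R s (s (s x))"
      by (intro tendsto_intros iter_lim lim)
    moreover have "(\<lambda>n. ?s (Suc n) x) \<longlonglongrightarrow> s x" using lim by (rule LIMSEQ_Suc)
    ultimately have "(3/2) *\<^sub>R s x - (1/2) *\<^sub>R s (s (s x)) = s x" using LIMSEQ_unique by auto
    moreover have "(3/2) *\<^sub>R s x = (1/2) *\<^sub>R s x + s x"
      using scaleR_add_left[of "1/2" 1 "s x"] by simp
    ultimately have "(1/2) *\<^sub>R s (s (s x)) = (1/2) *\<^sub>R s x" by (simp add: algebra_simps)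
    then show ?thesis by simp
  qed
  interpret A: bounded_linear A using A(1) by (rule symmetric_op_bounded_linear)
  have As: "A (s x) = s (A x)" for x
    using com[OF A.bounded_linear_axioms] by (simp add: commute_def)
  \<comment> \<open>\<open>A\<close> is the iterate of index 0, so monotonicity with n = 0 passes to
    the limit as A^2 \<le> A s.\<close>
  have Aspos: "0 \<le> inner (A (s x)) x" and Ale: "(norm (A x))\<^sup>2 \<le> inner (A (s x)) x" for x
  proof -
    have l: "(\<lambda>n. inner (A (?s n x)) x) \<longlonglongrightarrow> inner (A (s x)) x"
      by (intro tendsto_intros A.tendsto lim)
    show "(norm (A x))\<^sup>2 \<le> inner (A (s x)) x"
      using sign_iter_monotone(2)[OF A, of 0] by (intro LIMSEQ_le_const[OF l]) auto
    then show "0 \<le> inner (A (s x)) x" using zero_le_power2 order_trans by blast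
  qed
  define E where "E x = (1/2) *\<^sub>R (s (s x) + s x)" for x
  show thesis
  proof
    show "symmetric_op E"
      unfolding E_def symmetric_op_def
      using bounded_linear_const_scaleR[OF bounded_linear_add[OF bounded_linear_compose[OF bl bl] bl], of "1/2"]
      by (simp add: inner_add sym)
    show EE: "E (E x) = E x" for x
      by (simp add: E_def s.add s.scaleR s3 scaleR_left.add[symmetric] add.commute add.left_commute)
    show "commute B E" if "bounded_linear B" "commute B A" for B
    proof -
      have "commute B s" using that by (rule com)
      then show ?thesis
        unfolding E_def using that(1)
        by (intro commute_scaleR commute_add) (simp_all add: commute_def)
    qed
    show "0 \<le> inner (A x) x" if "E x = x" for x
    proof -
      have "s (E x) = E x" by (simp add: E_def s.add s.scaleR s3 add.commute)
      then show ?thesis using Aspos[of x] that by simp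
    qed
    show "inner (A x) x \<le> 0" if "E x = 0" for x
    proof -
      have ss: "s (s x) = - s x" using that by (simp add: E_def eq_neg_iff_add_eq_0)
      \<comment> \<open>The vector x - s^2 x is killed by \<open>s\<close>, and the bound A^2 \<le>
        A s shows that the kernel of \<open>s\<close> lies in that of \<open>A\<close>.\<close>
      have "A (x - s (s x)) = 0"
        using Ale[of "x - s (s x)"] by (simp add: s.diff s3 A.zero)
      then have "A x = - A (s x)" by (simp add: ss A.add eq_neg_iff_add_eq_0)
      then show ?thesis using Aspos[of x] by simp
    qed
  qed
qed

lemma spectral_cut:
  fixes A :: "'a::{real_inner, complete_space} \<Rightarrow> 'a"
  assumes A: "symmetric_op A"
  obtains E where "symmetric_op E" "\<And>x. E (E x) = E x"
    "\<And>B. bounded_linear B \<Longrightarrow> commute B A \<Longrightarrow> commute B E"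
    "\<And>x. E x = x \<Longrightarrow> 0 \<le> inner (A x) x" "\<And>x. E x = 0 \<Longrightarrow> inner (A x) x \<le> 0"
proof -
  obtain K where K: "K > 0" "\<And>x. norm (A x) \<le> norm x * K"
    using bounded_linear.pos_bounded[OF symmetric_op_bounded_linear[OF A]] by blast
  let ?A = "\<lambda>x. (1/K) *\<^sub>R A x"
  have "norm (?A x) \<le> norm x" for x
    using K(1) K(2)[of x] by (simp add: field_simps)
  then obtain E where E: "symmetric_op E" "\<And>x. E (E x) = E x"
    "\<And>B. bounded_linear B \<Longrightarrow> commute B ?A \<Longrightarrow> commute B E"
    "\<And>x. E x = x \<Longrightarrow> 0 \<le> inner (?A x) x" "\<And>x. E x = 0 \<Longrightarrow> inner (?A x) x \<le> 0"
    using spectral_cut_contraction[of ?A] symmetric_op_scaleR[OF A, of "1/K"] by blast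
  show thesis
  proof
    show "commute B E" if "bounded_linear B" "commute B A" for B
      using E(3)[OF that(1)] that by (simp add: commute_scaleR)
    show "0 \<le> inner (A x) x" if "E x = x" for x
      using E(4)[OF that] K(1) by (simp add: zero_le_divide_iff)
    show "inner (A x) x \<le> 0" if "E x = 0" for x
      using E(5)[OF that] K(1) by (simp add: divide_le_0_iff)
  qed (use E in auto)
qed

section \<open>Normal operators are quasitriangular\<close>

lemma cinner_add_right: "cinner x (y + z) = cinner x y + cinner x z"
  for x :: "'a::complex_inner"
  by (metis cinner_add_left cinner_commute complex_cnj_add)

lemma cinner_scaleC_right: "cinner x (a *\<^sub>C y) = cnj a * cinner x y"
  for x :: "'a::complex_inner"
  by (metis cinner_commute cinner_scaleC_left complex_cnj_mult)

lemma cinner_zero_left [simp]: "cinner 0 x = 0" for x :: "'a::complex_inner"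
  using cinner_add_left[of 0 0 x] by simp

lemma cinner_zero_right [simp]: "cinner x 0 = 0" for x :: "'a::complex_inner"
  using cinner_add_right[of x 0 0] by simp

lemma cinner_diff_left: "cinner (x - y) z = cinner x z - cinner y z" for x :: "'a::complex_inner"
  using cinner_add_left[of "x - y" y z] by simp

lemma cinner_diff_right: "cinner x (y - z) = cinner x y - cinner x z" for x :: "'a::complex_inner"
  using cinner_add_right[of x "y - z" z] by simp

lemma cinner_sum_left: "cinner (\<Sum>i\<in>I. f i) y = (\<Sum>i\<in>I. cinner (f i) y)" for y :: "'a::complex_inner"
  by (induction I rule: infinite_finite_induct) (simp_all add: cinner_add_left)

lemma cinner_sum_right: "cinner y (\<Sum>i\<in>I. f i) = (\<Sum>i\<in>I. cinner y (f i))" for y :: "'a::complex_inner"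
  by (induction I rule: infinite_finite_induct) (simp_all add: cinner_add_right)

lemmas cinner_simps = cinner_add_left cinner_add_right cinner_diff_left cinner_diff_right
  cinner_scaleC_left cinner_scaleC_right

lemma cinner_self: "cinner x x = complex_of_real ((norm x)\<^sup>2)" for x :: "'a::complex_inner"
proof -
  have "Im (cinner x x) = 0" using cinner_commute[of x x] by (simp add: complex_eq_iff)
  then show ?thesis by (simp add: complex_eq_iff power2_norm_eq_inner inner_eq_Re_cinner)
qed

lemma norm_scaleC: "norm (a *\<^sub>C x) = cmod a * norm x" for x :: "'a::complex_inner"
proof -
  have "complex_of_real ((norm (a *\<^sub>C x))\<^sup>2) = (a * cnj a) * complex_of_real ((norm x)\<^sup>2)"
    by (simp only: cinner_self[symmetric] cinner_simps) simp
  also have "\<dots> = complex_of_real ((cmod a * norm x)\<^sup>2)"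
    by (simp add: complex_norm_square[symmetric] power_mult_distrib)
  finally show ?thesis by (simp only: of_real_eq_iff) (simp add: power2_eq_iff_nonneg)
qed

lemma cinner_norm_le: "cmod (cinner x y) \<le> norm x * norm y" for x :: "'a::complex_inner"
proof (cases "cinner x y = 0")
  case False
  \<comment> \<open>Rotating \<open>x\<close> by this phase makes the inner product real, so that
    the real Cauchy-Schwarz inequality applies.\<close>
  define u where "u = cnj (sgn (cinner x y))"
  have u: "cmod u = 1" using False by (simp add: u_def norm_sgn)
  have "u * cinner x y = complex_of_real (cmod (cinner x y))"
    using False by (simp add: u_def sgn_eq complex_norm_square[symmetric] mult.commute power2_eq_square)
  then have "cmod (cinner x y) = inner (u *\<^sub>C x) y"
    by (simp add: inner_eq_Re_cinner cinner_scaleC_left)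
  also have "\<dots> \<le> norm (u *\<^sub>C x) * norm y" by (rule norm_cauchy_schwarz)
  finally show ?thesis by (simp add: norm_scaleC u)
qed simp

lemma cinner_scaleR_left: "cinner (r *\<^sub>R x) y = complex_of_real r * cinner x y" for x :: "'a::complex_inner"
  by (simp add: scaleR_scaleC cinner_scaleC_left)

lemma cinner_scaleR_right: "cinner x (r *\<^sub>R y) = complex_of_real r * cinner x y" for x :: "'a::complex_inner"
  by (simp add: scaleR_scaleC cinner_scaleC_right)

lemma bounded_linear_cinner_left: "bounded_linear (\<lambda>x. cinner x y)" for y :: "'a::complex_inner"
  by (rule bounded_linear_intro[where K = "norm y"])
    (simp_all add: cinner_simps cinner_scaleR_left cinner_norm_le scaleR_conv_of_real)

lemma bounded_linear_scaleC: "bounded_linear (\<lambda>x :: 'a::complex_inner. c *\<^sub>C x)"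
  by (rule bounded_linear_intro[where K = "cmod c"])
    (simp_all add: scaleC_add_right norm_scaleC scaleR_scaleC scaleC_scaleC mult.commute)

lemma bounded_clinearD:
  assumes "bounded_clinear T"
  shows "bounded_linear T" "T (c *\<^sub>C x) = c *\<^sub>C T x" "T (x + y) = T x + T y" "T (x - y) = T x - T y" "T 0 = 0"
  using assms by (auto simp: bounded_clinear_def linear_add linear_diff linear_0 bounded_linear.linear)

lemma bounded_clinear_sum: "bounded_clinear T \<Longrightarrow> T (\<Sum>i\<in>I. f i) = (\<Sum>i\<in>I. T (f i))"
  by (simp add: bounded_clinearD linear_sum bounded_linear.linear)

lemma bounded_clinear_compose:
  "bounded_clinear S \<Longrightarrow> bounded_clinear T \<Longrightarrow> bounded_clinear (\<lambda>x. S (T x))"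
  by (simp add: bounded_clinear_def bounded_linear_compose)

lemma bounded_clinear_add:
  "bounded_clinear S \<Longrightarrow> bounded_clinear T \<Longrightarrow> bounded_clinear (\<lambda>x. S x + T x)"
  by (simp add: bounded_clinear_def bounded_linear_add scaleC_add_right)

lemma bounded_clinear_diff:
  "bounded_clinear S \<Longrightarrow> bounded_clinear T \<Longrightarrow> bounded_clinear (\<lambda>x. S x - T x)"
  by (simp add: bounded_clinear_def bounded_linear_sub complex_vec.scale_right_diff_distrib)

lemma bounded_clinear_scaleC:
  "bounded_clinear S \<Longrightarrow> bounded_clinear (\<lambda>x. c *\<^sub>C S x)"
  by (simp add: bounded_clinear_def bounded_linear_compose[OF bounded_linear_scaleC] scaleC_scaleC mult.commute)

lemma bounded_clinear_ident: "bounded_clinear (\<lambda>x. x)"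
  by (simp add: bounded_clinear_def)

lemma bounded_clinear_rank_one: "bounded_clinear (\<lambda>x. cinner x f *\<^sub>C v)"
  for f :: "'a::complex_inner" and v :: "'b::complex_inner"
  unfolding bounded_clinear_def
proof
  show "bounded_linear (\<lambda>x. cinner x f *\<^sub>C v)"
  proof (rule bounded_linear_intro[where K = "norm f * norm v"])
    fix x show "norm (cinner x f *\<^sub>C v) \<le> norm x * (norm f * norm v)"
      using mult_right_mono[OF cinner_norm_le[of x f], of "norm v"] by (simp add: norm_scaleC mult.assoc)
  qed (simp_all add: cinner_simps scaleC_add_left cinner_scaleR_left scaleR_scaleC scaleC_scaleC)
qed (simp add: cinner_simps scaleC_scaleC)

lemma bounded_clinear_sum_fun:
  "(\<And>i. i \<in> I \<Longrightarrow> bounded_clinear (F i)) \<Longrightarrow> bounded_clinear (\<lambda>x. \<Sum>i\<in>I. F i x)"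
  by (induction I rule: infinite_finite_induct)
    (simp_all add: bounded_clinear_add, simp_all add: bounded_clinear_def)

lemma cadjointI:
  fixes T :: "'a::complex_hilbert_space \<Rightarrow> 'a"
  assumes "bounded_clinear T" "\<And>x y. cinner (T x) y = cinner x (S y)"
  shows "cadjoint T = S"
  by (intro ext cinner_eqI) (simp only: cadjoint_works[OF assms(1), symmetric] assms(2))

lemma cadjoint_works':
  fixes T :: "'a::complex_hilbert_space \<Rightarrow> 'a"
  assumes "bounded_clinear T"
  shows "cinner (cadjoint T x) y = cinner x (T y)"
  by (metis assms cadjoint_works cinner_commute)

lemma bounded_clinear_cadjoint:
  fixes T :: "'a::complex_hilbert_space \<Rightarrow> 'a"
  assumes T: "bounded_clinear T"
  shows "bounded_clinear (cadjoint T)"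
proof -
  note adj = cadjoint_works[OF T, symmetric]
  have sc: "cadjoint T (c *\<^sub>C x) = c *\<^sub>C cadjoint T x" for c x
    by (rule cinner_eqI) (simp add: adj cinner_simps)
  obtain K where K: "\<And>x. norm (T x) \<le> norm x * K" "K > 0"
    using bounded_linear.pos_bounded[OF bounded_clinearD(1)[OF T]] by blast
  have "bounded_linear (cadjoint T)"
  proof (rule bounded_linear_intro[where K = K])
    fix x y :: 'a and r :: real
    show "cadjoint T (x + y) = cadjoint T x + cadjoint T y"
      by (rule cinner_eqI) (simp add: adj cinner_simps)
    show "cadjoint T (r *\<^sub>R x) = r *\<^sub>R cadjoint T x"
      by (simp add: scaleR_scaleC sc)
    have "(norm (cadjoint T x))\<^sup>2 = inner (T (cadjoint T x)) x"
      by (simp add: inner_eq_Re_cinner cadjoint_works[OF T] cinner_self)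
    also have "\<dots> \<le> norm (T (cadjoint T x)) * norm x" by (rule norm_cauchy_schwarz)
    also have "\<dots> \<le> (norm (cadjoint T x) * K) * norm x" by (intro mult_right_mono K) simp
    finally have "norm (cadjoint T x) * norm (cadjoint T x) \<le> norm (cadjoint T x) * (norm x * K)"
      by (simp add: power2_eq_square mult_ac)
    then show "norm (cadjoint T x) \<le> norm x * K"
      using K(2) by (cases "norm (cadjoint T x) = 0") (auto simp: mult_le_cancel_left)
  qed
  then show ?thesis by (simp add: bounded_clinear_def sc)
qed

section \<open>Orthogonal projections onto finite-dimensional subspaces\<close>

lemma orthogonal_projectionI:
  fixes P :: "'a::complex_hilbert_space \<Rightarrow> 'a"
  assumes "bounded_clinear P" "\<And>x. P (P x) = P x" "\<And>x y. cinner (P x) y = cinner x (P y)"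
  shows "orthogonal_projection P"
  using assms cadjointI[of P P] by (simp add: orthogonal_projection_def fun_eq_iff)

lemma orthogonal_projectionD:
  fixes P :: "'a::complex_hilbert_space \<Rightarrow> 'a"
  assumes "orthogonal_projection P"
  shows "bounded_clinear P" "P (P x) = P x" "cinner (P x) y = cinner x (P y)"
    "v \<in> range P \<Longrightarrow> P v = v"
  using assms cadjoint_works[of P] by (auto simp: orthogonal_projection_def fun_eq_iff)

lemma orthogonal_projection_best_approx:
  fixes P :: "'a::complex_hilbert_space \<Rightarrow> 'a"
  assumes "orthogonal_projection P" "w \<in> range P"
  shows "norm (y - P y) \<le> norm (y - w)"
proof -
  note P = orthogonal_projectionD[OF assms(1)]
  have "cinner (y - P y) (P (P y - w)) = 0"
    unfolding P(3)[symmetric] by (simp add: bounded_clinearD(4)[OF P(1)] P(2))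
  then have "inner (y - P y) (P y - w) = 0"
    using P(4)[OF assms(2)] by (simp add: inner_eq_Re_cinner bounded_clinearD(4)[OF P(1)] P(2))
  then have "(norm ((y - P y) + (P y - w)))\<^sup>2 = (norm (y - P y))\<^sup>2 + (norm (P y - w))\<^sup>2"
    by (rule norm_add_Pythagorean[unfolded orthogonal_def])
  then have "(norm (y - P y))\<^sup>2 \<le> (norm (y - w))\<^sup>2" by simp
  then show ?thesis by (rule power2_le_imp_le) simp
qed

lemma orthogonal_projection_norm_le:
  fixes P :: "'a::complex_hilbert_space \<Rightarrow> 'a"
  assumes "orthogonal_projection P"
  shows "norm (P x) \<le> norm x"
proof -
  note P = orthogonal_projectionD[OF assms]
  have "(norm (P x))\<^sup>2 = inner x (P x)"
    by (metis P(2,3) inner_eq_Re_cinner power2_norm_eq_inner)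
  also have "\<dots> \<le> norm x * norm (P x)" by (rule norm_cauchy_schwarz)
  finally show ?thesis
    by (cases "norm (P x) = 0") (auto simp: power2_eq_square)
qed

text \<open>One Gram-Schmidt step per vector: the normalized residual \<open>u\<close> of
  \<open>b\<close> adds a rank-one projection orthogonal to \<open>P\<close>.\<close>

lemma ex_orthogonal_projection_cspan:
  fixes B :: "'a::complex_hilbert_space set"
  assumes "finite B"
  shows "\<exists>P. orthogonal_projection P \<and> range P = cspan B"
  using assms
proof (induction B)
  case empty
  have "orthogonal_projection (\<lambda>x :: 'a. 0)"
    by (rule orthogonal_projectionI) (simp_all add: bounded_clinear_def)
  then show ?case by (intro exI[of _ "\<lambda>x. 0"]) auto
next
  case (insert b B)
  then obtain P where oP: "orthogonal_projection P" and rP: "range P = cspan B" by blast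
  note P = orthogonal_projectionD[OF oP]
  define r where "r = b - P b"
  show ?case
  proof (cases "r = 0")
    case True
    then have "b \<in> cspan B" using rP by (metis r_def eq_iff_diff_eq_0 rangeI)
    then show ?thesis using oP rP by (metis complex_vec.span_redundant)
  next
    case False
    define u where "u = complex_of_real (1 / norm r) *\<^sub>C r"
    have uu: "cinner u u = 1" using False by (simp add: cinner_self u_def norm_scaleC norm_divide)
    have Pu: "P u = 0" by (simp add: u_def r_def bounded_clinearD[OF P(1)] P(2))
    have Pu': "cinner (P x) u = 0" for x using P(3)[of x u] by (simp add: Pu)
    have b: "b = P b + complex_of_real (norm r) *\<^sub>C u"
      using False by (simp add: u_def scaleC_scaleC r_def scaleC_one flip: of_real_mult)
    define P' where "P' x = P x + cinner x u *\<^sub>C u" for x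
    have "orthogonal_projection P'"
    proof (rule orthogonal_projectionI)
      show "bounded_clinear P'"
        unfolding P'_def by (intro bounded_clinear_add P(1) bounded_clinear_rank_one)
      show "P' (P' x) = P' x" for x
        by (simp add: P'_def bounded_clinearD[OF P(1)] P(2) Pu cinner_simps Pu' uu)
      show "cinner (P' x) y = cinner x (P' y)" for x y
        using cinner_commute[of u y] by (simp add: P'_def cinner_simps P(3))
    qed
    moreover have "range P' = cspan (insert b B)"
    proof
      have u_in: "u \<in> cspan (insert b B)"
      proof -
        have "P b \<in> cspan (insert b B)"
          using rP complex_vec.span_mono[of B "insert b B"] by auto
        then show ?thesis unfolding u_def r_def
          by (intro complex_vec.span_scale complex_vec.span_diff) (auto intro: complex_vec.span_base)
      qed
      have "P x \<in> cspan (insert b B)" for x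
        using rP complex_vec.span_mono[of B "insert b B"] by auto
      then show "range P' \<subseteq> cspan (insert b B)"
        unfolding P'_def using u_in by (auto intro!: complex_vec.span_add complex_vec.span_scale)
      show "cspan (insert b B) \<subseteq> range P'"
      proof
        fix v assume "v \<in> cspan (insert b B)"
        then obtain k where "v - k *\<^sub>C b \<in> cspan B" by (auto simp: complex_vec.span_insert)
        then obtain z where "v - k *\<^sub>C b = P z" using rP by auto
        moreover have "k *\<^sub>C b = k *\<^sub>C P b + (k * complex_of_real (norm r)) *\<^sub>C u"
          using arg_cong[OF b, of "\<lambda>z. k *\<^sub>C z"] by (simp add: scaleC_add_right scaleC_scaleC)
        ultimately have v: "v = P (z + k *\<^sub>C b) + (k * complex_of_real (norm r)) *\<^sub>C u"
          by (simp add: bounded_clinearD[OF P(1)] P(2) Pu diff_eq_eq add.assoc)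
        have "P' (P w + c *\<^sub>C u) = P w + c *\<^sub>C u" for w c
          by (simp add: P'_def bounded_clinearD[OF P(1)] P(2) Pu cinner_simps Pu' uu)
        then have "P' v = v" using v by simp
        then show "v \<in> range P'" by (metis rangeI)
      qed
    qed
    ultimately show ?thesis by blast
  qed
qed

section \<open>Almost invariant subspaces inside reducing subspaces\<close>

definition almost_invariant :: "('a::complex_inner \<Rightarrow> 'a) \<Rightarrow> real \<Rightarrow> 'a set \<Rightarrow> bool"
  where "almost_invariant T r V \<longleftrightarrow> (\<forall>v\<in>V. \<exists>w\<in>V. norm (T v - w) \<le> r * norm v)"

text \<open>The family \<open>C\<close> collects all that a spectral piece must respect; scalar
  multiplications are later put into it to make \<open>Q\<close> complex-linear.\<close>

definition reducing :: "('a::complex_inner \<Rightarrow> 'a) set \<Rightarrow> ('a \<Rightarrow> 'a) \<Rightarrow> bool"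
  where "reducing C Q \<longleftrightarrow> symmetric_op Q \<and> (\<forall>x. Q (Q x) = Q x) \<and> (\<forall>B\<in>C. commute B Q)"

text \<open>The subspace must stay inside \<open>range Q\<close>, so that subspaces found in
  orthogonal pieces are orthogonal.\<close>

definition absorbing :: "('a::complex_inner \<Rightarrow> 'a) \<Rightarrow> real \<Rightarrow> ('a \<Rightarrow> 'a) \<Rightarrow> bool"
  where "absorbing T r Q \<longleftrightarrow> (\<forall>F. finite F \<and> F \<subseteq> range Q \<longrightarrow>
    (\<exists>G. finite G \<and> F \<subseteq> cspan G \<and> cspan G \<subseteq> range Q \<and> almost_invariant T r (cspan G)))"

text \<open>Errors in the two pieces are orthogonal and add up by Pythagoras, so the tolerance
  \<open>r\<close> does not grow and arbitrarily many pieces can be joined.\<close>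

lemma absorbing_sum:
  assumes T: "bounded_linear T" and r: "0 \<le> r"
    and Q1: "symmetric_op Q1" "\<And>x. Q1 (Q1 x) = Q1 x" "commute T Q1" "absorbing T r Q1"
    and Q2: "symmetric_op Q2" "\<And>x. Q2 (Q2 x) = Q2 x" "commute T Q2" "absorbing T r Q2"
    and Q12: "\<And>x. Q1 (Q2 x) = 0" and Q: "\<And>x. Q x = Q1 x + Q2 x"
  shows "absorbing T r Q"
proof -
  have bl1: "linear Q1" and bl2: "linear Q2"
    using Q1 Q2 by (simp_all add: symmetric_op_def bounded_linear.linear)
  have fix1: "Q1 v = v" if "v \<in> range Q1" for v using that Q1(2) by auto
  have fix2: "Q2 v = v" if "v \<in> range Q2" for v using that Q2(2) by auto
  have Q21: "Q2 (Q1 x) = 0" for x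
  proof -
    have "inner (Q2 (Q1 x)) (Q2 (Q1 x)) = inner x (Q1 (Q2 (Q2 (Q1 x))))"
      by (metis symmetric_opD[OF Q1(1)] symmetric_opD[OF Q2(1)])
    then show ?thesis by (simp add: Q12)
  qed
  have orth: "(norm (v1 + v2))\<^sup>2 = (norm v1)\<^sup>2 + (norm v2)\<^sup>2" if "v1 \<in> range Q1" "v2 \<in> range Q2" for v1 v2
  proof -
    have "inner (Q1 v1) (Q2 v2) = 0" using symmetric_opD[OF Q1(1), of v1 "Q2 v2"] by (simp add: Q12)
    then have "inner v1 v2 = 0" using fix1[OF that(1)] fix2[OF that(2)] by simp
    then show ?thesis by (rule norm_add_Pythagorean[unfolded orthogonal_def])
  qed
  show ?thesis
    unfolding absorbing_def
  proof (intro allI impI)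
    fix F assume F: "finite F \<and> F \<subseteq> range Q"
    obtain G1 where G1: "finite G1" "Q1 ` F \<subseteq> cspan G1" "cspan G1 \<subseteq> range Q1" "almost_invariant T r (cspan G1)"
      using Q1(4)[unfolded absorbing_def, rule_format, of "Q1 ` F"] F by blast
    obtain G2 where G2: "finite G2" "Q2 ` F \<subseteq> cspan G2" "cspan G2 \<subseteq> range Q2" "almost_invariant T r (cspan G2)"
      using Q2(4)[unfolded absorbing_def, rule_format, of "Q2 ` F"] F by blast
    have span: "v \<in> cspan (G1 \<union> G2) \<longleftrightarrow> (\<exists>v1\<in>cspan G1. \<exists>v2\<in>cspan G2. v = v1 + v2)" for v
      by (auto simp: complex_vec.span_Un)
    have "F \<subseteq> cspan (G1 \<union> G2)"
    proof
      fix f assume "f \<in> F"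
      then obtain z where "f = Q z" using F by auto
      then have "f = Q1 f + Q2 f"
        by (simp add: Q linear_add[OF bl1] linear_add[OF bl2] Q1(2) Q2(2) Q12 Q21)
      then show "f \<in> cspan (G1 \<union> G2)" using G1(2) G2(2) \<open>f \<in> F\<close> unfolding span by blast
    qed
    moreover have "cspan (G1 \<union> G2) \<subseteq> range Q"
    proof
      fix v assume "v \<in> cspan (G1 \<union> G2)"
      then obtain v1 v2 where v: "v1 \<in> cspan G1" "v2 \<in> cspan G2" "v = v1 + v2" by (auto simp: span)
      have f: "Q1 v1 = v1" "Q2 v2 = v2" using v G1(3) G2(3) fix1 fix2 by blast+
      have "Q v = v"
        using Q12[of v2] Q21[of v1] by (simp add: Q v(3) linear_add[OF bl1] linear_add[OF bl2] f)
      then show "v \<in> range Q" by (metis rangeI)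
    qed
    moreover have "almost_invariant T r (cspan (G1 \<union> G2))"
      unfolding almost_invariant_def
    proof
      fix v assume "v \<in> cspan (G1 \<union> G2)"
      then obtain v1 v2 where v: "v1 \<in> cspan G1" "v2 \<in> cspan G2" "v = v1 + v2" by (auto simp: span)
      obtain w1 where w1: "w1 \<in> cspan G1" "norm (T v1 - w1) \<le> r * norm v1"
        using G1(4) v by (auto simp: almost_invariant_def)
      obtain w2 where w2: "w2 \<in> cspan G2" "norm (T v2 - w2) \<le> r * norm v2"
        using G2(4) v by (auto simp: almost_invariant_def)
      \<comment> \<open>\<open>T\<close> commutes with \<open>Q1\<close>, so the error made in the
        first piece stays there.\<close>
      have "Q1 (T v1 - w1) = T v1 - w1"
        using fix1[OF subsetD[OF G1(3) v(1)]] fix1[OF subsetD[OF G1(3) w1(1)]] commuteD[OF Q1(3), of v1, symmetric]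
        by (simp add: linear_diff[OF bl1])
      then have r1: "T v1 - w1 \<in> range Q1" by (metis rangeI)
      have "Q2 (T v2 - w2) = T v2 - w2"
        using fix2[OF subsetD[OF G2(3) v(2)]] fix2[OF subsetD[OF G2(3) w2(1)]] commuteD[OF Q2(3), of v2, symmetric]
        by (simp add: linear_diff[OF bl2])
      then have r2: "T v2 - w2 \<in> range Q2" by (metis rangeI)
      have "(norm (T v - (w1 + w2)))\<^sup>2 = (norm ((T v1 - w1) + (T v2 - w2)))\<^sup>2"
        using T by (simp add: v(3) linear_add bounded_linear.linear algebra_simps)
      also have "\<dots> = (norm (T v1 - w1))\<^sup>2 + (norm (T v2 - w2))\<^sup>2"
        using r1 r2 by (rule orth)
      also have "\<dots> \<le> (r * norm v1)\<^sup>2 + (r * norm v2)\<^sup>2"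
        by (intro add_mono power_mono w1 w2) auto
      also have "\<dots> = r\<^sup>2 * (norm (v1 + v2))\<^sup>2"
        using v G1(3) G2(3) by (subst orth) (auto simp: power_mult_distrib algebra_simps)
      finally have "(norm (T v - (w1 + w2)))\<^sup>2 \<le> (r * norm v)\<^sup>2"
        by (simp add: v(3) power_mult_distrib)
      then have "norm (T v - (w1 + w2)) \<le> r * norm v"
        using r by (meson mult_nonneg_nonneg norm_ge_zero power2_le_imp_le)
      then show "\<exists>w\<in>cspan (G1 \<union> G2). norm (T v - w) \<le> r * norm v"
        using w1(1) w2(1) span by blast
    qed
    ultimately show "\<exists>G. finite G \<and> F \<subseteq> cspan G \<and> cspan G \<subseteq> range Q \<and> almost_invariant T r (cspan G)"
      using G1(1) G2(1) by blast
  qed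
qed

text \<open>The form bound says that d - A and d + A are nonnegative on the range of
  \<open>Q\<close>. They commute, so their product d^2 - A^2 is nonnegative there too.\<close>

lemma symmetric_norm_le_of_form:
  assumes A: "symmetric_op A" and Q: "symmetric_op Q" "\<And>x. Q (Q x) = Q x" "commute A Q"
    and form: "\<And>v. v \<in> range Q \<Longrightarrow> \<bar>inner (A v) v\<bar> \<le> d * (norm v)\<^sup>2"
    and d: "0 \<le> d" and v: "v \<in> range Q"
  shows "norm (A v) \<le> d * norm v"
proof -
  have bl: "linear A" "linear Q" using A Q by (simp_all add: symmetric_op_def bounded_linear.linear)
  have comm: "Q (A x) = A (Q x)" for x using Q(3) by (simp add: commute_def)
  have Qv: "Q v = v" using v Q(2) by auto
  have sAQ: "symmetric_op (\<lambda>x. A (Q x))" by (rule symmetric_op_compose[OF A Q(1) Q(3)])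
  have AQ: "inner (A (Q x)) x = inner (A (Q x)) (Q x)" for x
    using symmetric_opD[OF Q(1), of "A (Q x)" x] by (simp add: comm Q(2))
  have QQ: "inner (Q x) x = (norm (Q x))\<^sup>2" for x
    using symmetric_opD[OF Q(1), of "Q x" x] by (simp add: Q(2) power2_norm_eq_inner)
  let ?X = "\<lambda>x. d *\<^sub>R Q x - A (Q x)" and ?Y = "\<lambda>x. d *\<^sub>R Q x + A (Q x)"
  have nX: "nonneg_op ?X" and nY: "nonneg_op ?Y"
    unfolding nonneg_op_def using form[OF rangeI, of x for x]
    by (simp_all add: inner_diff inner_add AQ QQ abs_le_iff) (metis add.commute neg_le_iff_le diff_ge_0_iff_ge diff_minus_eq_add minus_le_iff)
  have "nonneg_op (\<lambda>x. ?X (?Y x))"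
  proof (rule nonneg_op_compose[OF _ nX _ nY])
    show "symmetric_op ?X" "symmetric_op ?Y"
      by (intro symmetric_op_diff symmetric_op_add symmetric_op_scaleR Q(1) sAQ)+
    show "commute ?X ?Y"
      by (simp add: commute_def linear_add[OF bl(1)] linear_add[OF bl(2)] linear_diff[OF bl(1)] linear_diff[OF bl(2)]
          linear_scale[OF bl(1)] linear_scale[OF bl(2)] comm Q(2) algebra_simps)
  qed
  then have "0 \<le> inner (?X (?Y v)) v" by (rule nonneg_opD)
  also have "?X (?Y v) = (d * d) *\<^sub>R v - A (A v)"
    by (simp add: linear_add[OF bl(1)] linear_add[OF bl(2)] linear_scale[OF bl(1)] linear_scale[OF bl(2)] Qv comm algebra_simps)
  finally have "(norm (A v))\<^sup>2 \<le> (d * norm v)\<^sup>2"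
    by (simp add: inner_diff symmetric_opD[OF A] power2_norm_eq_inner power_mult_distrib) (simp add: power2_eq_square)
  then show ?thesis using d by (meson mult_nonneg_nonneg norm_ge_zero power2_le_imp_le)
qed

text \<open>Halving an interval that contains the form values of \<open>A\<close> reduces the claim
  to pieces on which \<open>A\<close> is within \<open>d\<close> of a real scalar. The hypothesis
  \<open>small\<close> treats such pieces; leaving it open allows a second bisection, for another
  operator, inside it.\<close>

lemma absorbing_bisect:
  fixes A :: "'a::complex_hilbert_space \<Rightarrow> 'a"
  assumes T: "bounded_linear T" "T \<in> C" and r: "0 \<le> r" and d: "0 < d"
    and A: "symmetric_op A" "A \<in> C" "\<And>B. B \<in> C \<Longrightarrow> commute B A" and C: "\<And>B. B \<in> C \<Longrightarrow> bounded_linear B"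
    and small: "\<And>Q' c. reducing C Q' \<Longrightarrow> range Q' \<subseteq> range Q \<Longrightarrow>
      (\<And>v. v \<in> range Q' \<Longrightarrow> norm (A v - c *\<^sub>R v) \<le> d * norm v) \<Longrightarrow> absorbing T r Q'"
    and Q: "reducing C Q"
  shows "absorbing T r Q"
proof -
  have "absorbing T r Q'"
    if "reducing C Q'" "range Q' \<subseteq> range Q" "h - l \<le> 2 ^ k * (2 * d)"
      "\<And>v. v \<in> range Q' \<Longrightarrow> l * (norm v)\<^sup>2 \<le> inner (A v) v \<and> inner (A v) v \<le> h * (norm v)\<^sup>2" for k Q' l h
    using that
  proof (induction k arbitrary: Q' l h)
    case 0
    define m where "m = (l + h) / 2"
    have Q': "symmetric_op Q'" "\<And>x. Q' (Q' x) = Q' x" "commute A Q'"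
      using 0(1) A by (auto simp: reducing_def)
    have "norm (A v - m *\<^sub>R v) \<le> d * norm v" if v: "v \<in> range Q'" for v
    proof (rule symmetric_norm_le_of_form[where A = "\<lambda>x. A x - m *\<^sub>R x" and Q = Q'])
      show "symmetric_op (\<lambda>x. A x - m *\<^sub>R x)"
        by (intro symmetric_op_diff symmetric_op_scaleR symmetric_op_ident A(1))
      show "commute (\<lambda>x. A x - m *\<^sub>R x) Q'"
        using Q'(3) symmetric_op_bounded_linear[OF Q'(1)]
        by (simp add: commute_def linear_diff linear_scale bounded_linear.linear)
      fix v assume v: "v \<in> range Q'"
      have w: "(h - m) * (norm v)\<^sup>2 \<le> d * (norm v)\<^sup>2" "(m - l) * (norm v)\<^sup>2 \<le> d * (norm v)\<^sup>2"
        using 0(3) by (intro mult_right_mono; simp add: m_def field_simps)+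
      show "\<bar>inner (A v - m *\<^sub>R v) v\<bar> \<le> d * (norm v)\<^sup>2"
        using 0(4)[OF v] w by (simp add: inner_diff power2_norm_eq_inner[symmetric] abs_le_iff algebra_simps)
    qed (use Q' d v in auto)
    then show ?case using 0(1,2) small by blast
  next
    case (Suc k)
    define m where "m = (l + h) / 2"
    have Q': "symmetric_op Q'" "\<And>x. Q' (Q' x) = Q' x" "\<And>B. B \<in> C \<Longrightarrow> commute B Q'"
      using Suc(2) A by (auto simp: reducing_def)
    have blQ: "bounded_linear Q'" using Q'(1) by (rule symmetric_op_bounded_linear)
    have sm: "symmetric_op (\<lambda>x. A x - m *\<^sub>R x)"
      by (intro symmetric_op_diff symmetric_op_scaleR symmetric_op_ident A(1))
    obtain E where E: "symmetric_op E" "\<And>x. E (E x) = E x"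
      "\<And>B. bounded_linear B \<Longrightarrow> commute B (\<lambda>x. A x - m *\<^sub>R x) \<Longrightarrow> commute B E"
      "\<And>x. E x = x \<Longrightarrow> 0 \<le> inner (A x - m *\<^sub>R x) x" "\<And>x. E x = 0 \<Longrightarrow> inner (A x - m *\<^sub>R x) x \<le> 0"
      using spectral_cut[OF sm] by blast
    have blE: "bounded_linear E" using E(1) by (rule symmetric_op_bounded_linear)
    \<comment> \<open>\<open>Q'\<close> commutes with \<open>A\<close>, hence with the cut
      \<open>E\<close>, and so \<open>?Q1\<close> and \<open>?Q2\<close> below are again
      projections.\<close>
    have EC: "commute B E" if "bounded_linear B" "commute B A" for B
      using that by (intro E(3) commute_diff commute_scaleR commute_ident)
    have EQ: "commute E Q'" using EC[OF blQ] Q'(3)[OF A(2)] by (simp add: commute_sym)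
    then have EQ': "E (Q' x) = Q' (E x)" for x by (rule commuteD)
    have lin: "Q' (x - y) = Q' x - Q' y" "E (x - y) = E x - E y" "Q' 0 = 0" for x y
      using blQ blE by (simp_all add: linear_diff linear_0 bounded_linear.linear)
    let ?Q1 = "\<lambda>x. Q' (E x)" and ?Q2 = "\<lambda>x. Q' x - Q' (E x)"
    have s1: "symmetric_op ?Q1" by (rule symmetric_op_compose[OF Q'(1) E(1) commute_sym[OF EQ]])
    have s2: "symmetric_op ?Q2" by (rule symmetric_op_diff[OF Q'(1) s1])
    have red1: "reducing C ?Q1"
      unfolding reducing_def using s1 Q'(3) EC[OF C A(3)] by (auto simp: EQ' Q'(2) E(2) commute_def)
    have red2: "reducing C ?Q2"
      unfolding reducing_def
      using s2 Q'(3) EC[OF C A(3)] C by (auto simp: lin EQ' Q'(2) E(2) commute_def linear_diff bounded_linear.linear)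
    have sub1: "range ?Q1 \<subseteq> range Q'" by auto
    have sub2: "range ?Q2 \<subseteq> range Q'" by (auto simp flip: lin)
    have E1: "E v = v" if "v \<in> range ?Q1" for v using that by (auto simp: EQ' E(2))
    have E2: "E v = 0" if "v \<in> range ?Q2" for v using that by (auto simp: lin EQ' E(2))
    show ?case
    proof (rule absorbing_sum[OF T(1) r, of ?Q1 ?Q2])
      have w: "h - m \<le> 2 ^ k * (2 * d)" "m - l \<le> 2 ^ k * (2 * d)"
        using Suc(4) by (auto simp: m_def field_simps)
      show "absorbing T r ?Q1"
      proof (rule Suc.IH[OF red1 _ w(1)])
        fix v assume v: "v \<in> range ?Q1"
        show "m * (norm v)\<^sup>2 \<le> inner (A v) v \<and> inner (A v) v \<le> h * (norm v)\<^sup>2"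
          using Suc(5)[OF subsetD[OF sub1 v]] E(4)[OF E1[OF v]]
          by (simp add: inner_diff power2_norm_eq_inner)
      qed (use sub1 Suc(3) in blast)
      show "absorbing T r ?Q2"
      proof (rule Suc.IH[OF red2 _ w(2)])
        fix v assume v: "v \<in> range ?Q2"
        show "l * (norm v)\<^sup>2 \<le> inner (A v) v \<and> inner (A v) v \<le> m * (norm v)\<^sup>2"
          using Suc(5)[OF subsetD[OF sub2 v]] E(5)[OF E2[OF v]]
          by (simp add: inner_diff power2_norm_eq_inner)
      qed (use sub2 Suc(3) in blast)
      show "commute T ?Q1" "commute T ?Q2" using red1 red2 T(2) by (auto simp: reducing_def)
    qed (use s1 s2 in \<open>simp_all add: lin EQ' Q'(2) E(2)\<close>)
  qed
  note main = this
  obtain K where K: "K > 0" "\<And>x. norm (A x) \<le> norm x * K"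
    using bounded_linear.pos_bounded[OF symmetric_op_bounded_linear[OF A(1)]] by blast
  have "\<bar>inner (A v) v\<bar> \<le> K * (norm v)\<^sup>2" for v
  proof -
    have "\<bar>inner (A v) v\<bar> \<le> norm (A v) * norm v" by (rule Cauchy_Schwarz_ineq2)
    also have "\<dots> \<le> norm v * K * norm v" using K by (intro mult_right_mono) auto
    finally show ?thesis by (simp add: power2_eq_square mult_ac)
  qed
  then have *: "- K * (norm v)\<^sup>2 \<le> inner (A v) v \<and> inner (A v) v \<le> K * (norm v)\<^sup>2" for v
    by (auto simp: abs_le_iff) (smt (verit))
  \<comment> \<open>The form values start in [-K, K]; after \<open>k\<close> halvings the length is
    at most 2 d, that is, distance \<open>d\<close> from the midpoint.\<close>
  obtain k where "K / d < 2 ^ k" using real_arch_pow[of 2 "K / d"] by auto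
  then have "K - - K \<le> 2 ^ k * (2 * d)" using d by (simp add: field_simps)
  then show ?thesis using main[OF Q order_refl] * by blast
qed

text \<open>Normality makes \<open>H\<close> and \<open>K\<close>, the real and imaginary parts of
  \<open>T\<close>, commute with each other and with \<open>T\<close>. Two nested bisections bring
  each within \<open>d\<close> of a scalar, hence the tolerance 2 d.\<close>

lemma normal_absorbing:
  fixes T :: "'a::complex_hilbert_space \<Rightarrow> 'a"
  assumes T: "bounded_clinear T" and normal: "normal_operator T" and d: "0 < d"
  shows "absorbing T (2 * d) (\<lambda>x. x)"
proof -
  let ?S = "cadjoint T"
  have S: "bounded_clinear ?S" using T by (rule bounded_clinear_cadjoint)
  have TS: "?S (T x) = T (?S x)" for x
    using normal by (simp add: normal_operator_def fun_eq_iff)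
  define H where "H x = (1/2) *\<^sub>C (T x + ?S x)" for x
  define K where "K x = (- \<i>/2) *\<^sub>C (T x - ?S x)" for x
  have bH: "bounded_clinear H" unfolding H_def by (intro bounded_clinear_scaleC bounded_clinear_add S T)
  have bK: "bounded_clinear K" unfolding K_def by (intro bounded_clinear_scaleC bounded_clinear_diff S T)
  have sH: "symmetric_op H"
    unfolding symmetric_op_def using bounded_clinearD(1)[OF bH]
    by (simp add: H_def inner_eq_Re_cinner cinner_simps cadjoint_works[OF T] cadjoint_works'[OF T] algebra_simps)
  have sK: "symmetric_op K"
    unfolding symmetric_op_def using bounded_clinearD(1)[OF bK]
    by (simp add: K_def inner_eq_Re_cinner cinner_simps cadjoint_works[OF T] cadjoint_works'[OF T] algebra_simps
        del: complex_vec.scale_minus_left)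
  have TH: "T x = H x + \<i> *\<^sub>C K x" for x
    by (simp add: H_def K_def scaleC_scaleC complex_vec.scale_right_diff_distrib scaleC_add_right
        flip: scaleC_add_left complex_vec.scale_left_distrib)
  note lin = bounded_clinearD(2-4)[OF T] bounded_clinearD(2-4)[OF S]
  \<comment> \<open>Commutation with \<open>scaleC\<close> is what makes the final ranges closed
    under complex scalars.\<close>
  define C where "C = {T, H, K} \<union> range scaleC"
  have CH: "commute B H" if "B \<in> C" for B
    using that by (auto simp: C_def commute_def H_def K_def lin TS scaleC_scaleC scaleC_add_right
        complex_vec.scale_right_diff_distrib algebra_simps simp del: complex_vec.scale_minus_left)
  have CK: "commute B K" if "B \<in> C" for B
    using that by (auto simp: C_def commute_def H_def K_def lin TS scaleC_scaleC scaleC_add_right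
        complex_vec.scale_right_diff_distrib algebra_simps simp del: complex_vec.scale_minus_left)
  have bC: "bounded_linear B" if "B \<in> C" for B
    using that bounded_clinearD(1)[OF T] bounded_clinearD(1)[OF bH] bounded_clinearD(1)[OF bK] bounded_linear_scaleC
    by (auto simp: C_def)
  have mem: "T \<in> C" "H \<in> C" "K \<in> C" by (auto simp: C_def)
  have red: "reducing C (\<lambda>x. x)"
    by (simp add: reducing_def symmetric_op_ident commute_ident)
  note bisect = absorbing_bisect[OF bounded_clinearD(1)[OF T] mem(1) _ d, of "2 * d"]
  show ?thesis
  proof (rule bisect[OF _ sH mem(2) CH bC _ red])
    fix Q c assume Q: "reducing C Q" and cH: "\<And>v. v \<in> range Q \<Longrightarrow> norm (H v - c *\<^sub>R v) \<le> d * norm v"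
    show "absorbing T (2 * d) Q"
    proof (rule bisect[OF _ sK mem(3) CK bC _ Q])
      fix Q' c' assume Q': "reducing C Q'" "range Q' \<subseteq> range Q"
        and cK: "\<And>v. v \<in> range Q' \<Longrightarrow> norm (K v - c' *\<^sub>R v) \<le> d * norm v"
      show "absorbing T (2 * d) Q'"
        unfolding absorbing_def
      proof (intro allI impI exI conjI)
        \<comment> \<open>On this range \<open>T\<close> is within 2 d of the scalar
          \<open>Complex c c'\<close>, so every subspace is almost invariant and \<open>F\<close>
          itself serves as generating set.\<close>
        fix F assume F: "finite F \<and> F \<subseteq> range Q'"
        show sub: "cspan F \<subseteq> range Q'"
        proof (rule complex_vec.span_minimal)
          have lQ: "linear Q'" and cQ: "Q' (a *\<^sub>C x) = a *\<^sub>C Q' x" for a x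
            using Q'(1) by (auto simp: reducing_def C_def symmetric_op_def bounded_linear.linear commute_def)
          show "complex_vec.subspace (range Q')"
          proof (rule complex_vec.subspaceI)
            show "0 \<in> range Q'" using linear_0[OF lQ] by (metis rangeI)
          qed (auto simp flip: linear_add[OF lQ] cQ)
        qed (use F in blast)
        show "almost_invariant T (2 * d) (cspan F)"
          unfolding almost_invariant_def
        proof (intro ballI bexI)
          fix v assume v: "v \<in> cspan F"
          have "T v - Complex c c' *\<^sub>C v = (H v - c *\<^sub>R v) + \<i> *\<^sub>C (K v - c' *\<^sub>R v)"
            by (simp add: TH Complex_eq scaleC_add_left scaleR_scaleC scaleC_scaleC complex_vec.scale_right_diff_distrib)
          also have "norm \<dots> \<le> norm (H v - c *\<^sub>R v) + norm (\<i> *\<^sub>C (K v - c' *\<^sub>R v))"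
            by (rule norm_triangle_ineq)
          also have "\<dots> \<le> d * norm v + d * norm v"
            using cH[of v] cK[of v] subsetD[OF sub v] subsetD[OF Q'(2), of v] by (simp add: norm_scaleC)
          finally show "norm (T v - Complex c c' *\<^sub>C v) \<le> 2 * d * norm v" by simp
          show "Complex c c' *\<^sub>C v \<in> cspan F" using v by (rule complex_vec.span_scale)
        qed
      qed (use complex_vec.span_superset in auto)
    qed (use d in auto)
  qed (use d in auto)
qed

section \<open>From almost invariant subspaces to an increasing sequence of projections\<close>

lemma orthonormal_basis_approx:
  fixes e :: "nat \<Rightarrow> 'a::complex_inner"
  assumes "orthonormal_basis e" "0 < r"
  shows "\<exists>n y. y \<in> cspan (e ` {..<n}) \<and> norm (x - y) < r"
proof -
  have "x \<in> closure (cspan (range e))" using assms(1) by (simp add: orthonormal_basis_def)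
  then obtain y where y: "y \<in> cspan (range e)" "dist y x < r"
    using assms(2) by (auto simp: closure_approachable)
  then obtain t c where t: "finite t" "t \<subseteq> range e" "y = (\<Sum>a\<in>t. c a *\<^sub>C a)"
    by (auto simp: complex_vec.span_explicit)
  then obtain J where J: "finite J" "t = e ` J" by (meson finite_subset_image)
  then obtain n where "J \<subseteq> {..<n}" using finite_nat_iff_bounded by blast
  then have "t \<subseteq> e ` {..<n}" using J by blast
  then have "y \<in> cspan (e ` {..<n})"
    unfolding t(3) by (intro complex_vec.span_sum complex_vec.span_scale complex_vec.span_base) blast
  moreover have "norm (x - y) < r" using y(2) by (simp add: dist_norm norm_minus_commute)
  ultimately show ?thesis by blast
qed

lemma absorbing_imp_quasitriangular:
  fixes T :: "'a::complex_hilbert_space \<Rightarrow> 'a" and e :: "nat \<Rightarrow> 'a"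
  assumes T: "bounded_clinear T" and e: "orthonormal_basis e"
    and absorb: "\<And>r. 0 < r \<Longrightarrow> absorbing T r (\<lambda>x. x)"
  shows "quasitriangular T"
proof -
  have "\<exists>G. finite G \<and> F \<subseteq> cspan G \<and> almost_invariant T r (cspan G)" if "finite F" "0 < r" for F r
    using absorb[OF that(2)] that(1) by (auto simp: absorbing_def)
  then obtain g where g: "\<And>F r. finite F \<Longrightarrow> 0 < r \<Longrightarrow>
      finite (g F r) \<and> F \<subseteq> cspan (g F r) \<and> almost_invariant T r (cspan (g F r))"
    by metis
  \<comment> \<open>Each stage absorbs the previous generators and the next basis vector: the former
    gives monotonicity, the latter strong convergence, and the tolerances tend to 0.\<close>
  define G where "G = rec_nat {} (\<lambda>n F. g (insert (e n) F) (1 / real (Suc n)))"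
  have GS: "G (Suc n) = g (insert (e n) (G n)) (1 / real (Suc n))" for n by (simp add: G_def)
  have fin: "finite (G n)" for n
  proof (induction n)
    case (Suc n) then show ?case using g[of "insert (e n) (G n)" "1 / real (Suc n)"] by (simp add: GS)
  qed (simp add: G_def)
  have G: "insert (e n) (G n) \<subseteq> cspan (G (Suc n))" "almost_invariant T (1 / real (Suc n)) (cspan (G (Suc n)))" for n
    using g[of "insert (e n) (G n)" "1 / real (Suc n)"] fin[of n] by (simp_all add: GS)
  obtain P0 where P0: "\<And>n. orthogonal_projection (P0 n) \<and> range (P0 n) = cspan (G n)"
    using ex_orthogonal_projection_cspan[OF fin] by metis
  have mono: "cspan (G m) \<subseteq> cspan (G n)" if "m \<le> n" for m n
    using that
  proof (induction n rule: dec_induct)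
    case (step n)
    have "cspan (G n) \<subseteq> cspan (G (Suc n))"
      using G(1)[of n] by (metis complex_vec.span_minimal complex_vec.subspace_span insert_subset)
    then show ?case using step by blast
  qed simp
  \<comment> \<open>The shift drops \<open>G 0\<close>, to which no tolerance is attached.\<close>
  define P where "P n = P0 (Suc n)" for n
  have oP: "orthogonal_projection (P n)" and rP: "range (P n) = cspan (G (Suc n))" for n
    using P0 by (auto simp: P_def)
  note PD = orthogonal_projectionD[OF oP]
  have fixP: "P n v = v" if "v \<in> cspan (G (Suc n))" for n v using that PD(4)[of v n] rP by simp
  have "finite_cdim (range (P n))" for n
    using fin[of "Suc n"] rP by (auto simp: finite_cdim_def)
  moreover have "positive_semidefinite (\<lambda>x. P (Suc n) x - P n x)" for n
  proof -
    have s: "cinner (P m x) x = complex_of_real ((norm (P m x))\<^sup>2)" for m x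
      by (metis PD(2,3) cinner_self)
    have "P (Suc n) (P n x) = P n x" for x
      using mono[of "Suc n" "Suc (Suc n)"] rP[of n] by (intro fixP) auto
    \<comment> \<open>This is the adjoint of the preceding identity.\<close>
    then have PP: "P n (P (Suc n) x) = P n x" for x
      by (intro cinner_eqI) (metis PD(3))
    have "norm (P n x) \<le> norm (P (Suc n) x)" for x
      using orthogonal_projection_norm_le[OF oP, of n "P (Suc n) x"] by (simp add: PP)
    then show ?thesis
      by (auto simp: positive_semidefinite_def cinner_diff_left s intro!: power_mono simp flip: of_real_diff of_real_power)
  qed
  moreover have "(\<lambda>n. P n x) \<longlonglongrightarrow> x" for x
  proof (rule metric_LIMSEQ_I)
    fix r :: real assume "0 < r"
    then obtain n y where y: "y \<in> cspan (e ` {..<n})" "norm (x - y) < r"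
      using orthonormal_basis_approx[OF e] by blast
    have "dist (P m x) x < r" if "n \<le> m" for m
    proof -
      have "e i \<in> cspan (G (Suc m))" if "i < n" for i
        using G(1)[of i] mono[of "Suc i" "Suc m"] that \<open>n \<le> m\<close> by auto
      then have "cspan (e ` {..<n}) \<subseteq> cspan (G (Suc m))"
        by (intro complex_vec.span_minimal) auto
      then have "y \<in> range (P m)" using y rP by auto
      then have "norm (x - P m x) \<le> norm (x - y)"
        by (rule orthogonal_projection_best_approx[OF oP])
      then show ?thesis using y by (simp add: dist_norm norm_minus_commute)
    qed
    then show "\<exists>n0. \<forall>m\<ge>n0. dist (P m x) x < r" by blast
  qed
  moreover have "(\<lambda>n. onorm (\<lambda>x. T (P n x) - P n (T (P n x)))) \<longlonglongrightarrow> 0"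
  proof (rule tendsto_sandwich[OF _ _ tendsto_const])
    show "(\<lambda>n. 1 / real (Suc n)) \<longlonglongrightarrow> 0"
      using LIMSEQ_Suc[OF lim_1_over_n] by simp
    have "norm (T (P n x) - P n (T (P n x))) \<le> 1 / real (Suc n) * norm x" for n x
    proof -
      have "P n x \<in> cspan (G (Suc n))" using rP by blast
      then obtain w where w: "w \<in> range (P n)" "norm (T (P n x) - w) \<le> 1 / real (Suc n) * norm (P n x)"
        using G(2)[of n] rP by (auto simp: almost_invariant_def)
      have "norm (T (P n x) - P n (T (P n x))) \<le> norm (T (P n x) - w)"
        by (rule orthogonal_projection_best_approx[OF oP w(1)])
      also have "\<dots> \<le> 1 / real (Suc n) * norm x"
        using w(2) orthogonal_projection_norm_le[OF oP, of n x]
        by (meson mult_left_mono order_trans of_nat_0_le_iff zero_le_divide_1_iff)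
      finally show ?thesis .
    qed
    then show "eventually (\<lambda>n. onorm (\<lambda>x. T (P n x) - P n (T (P n x))) \<le> 1 / real (Suc n)) sequentially"
      by (intro always_eventually allI onorm_bound) auto
    have "bounded_linear (\<lambda>x. T (P n x) - P n (T (P n x)))" for n
      by (intro bounded_clinearD(1) bounded_clinear_diff bounded_clinear_compose[OF T]
          bounded_clinear_compose[OF PD(1)] PD(1) T)
    then show "eventually (\<lambda>n. 0 \<le> onorm (\<lambda>x. T (P n x) - P n (T (P n x)))) sequentially"
      by (intro always_eventually allI onorm_pos_le)
  qed
  ultimately show ?thesis unfolding quasitriangular_def using oP by blast
qed

theorem normal_imp_quasitriangular:
  fixes T :: "'a::complex_hilbert_space \<Rightarrow> 'a" and e :: "nat \<Rightarrow> 'a"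
  assumes "bounded_clinear T" "orthonormal_basis e" "normal_operator T"
  shows "quasitriangular T"
proof (rule absorbing_imp_quasitriangular[OF assms(1,2)])
  fix r :: real assume "0 < r"
  then show "absorbing T r (\<lambda>x. x)" using normal_absorbing[OF assms(1,3), of "r / 2"] by simp
qed

section \<open>Quasitriangular operators that are bounded below\<close>

text \<open>A vector outside the image would enlarge the independent image of a basis
  \<open>S\<close> beyond the dimension of the span.\<close>

lemma finite_cdim_surj:
  fixes g :: "'a::complex_inner \<Rightarrow> 'a"
  assumes g: "bounded_clinear g" and B: "finite B" and into: "g ` cspan B \<subseteq> cspan B"
    and inj: "inj_on g (cspan B)"
  shows "g ` cspan B = cspan B"
proof -
  interpret g: module_hom scaleC scaleC g
    by unfold_locales (simp_all add: bounded_clinearD[OF g])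
  obtain S where S: "S \<subseteq> B" "complex_vec.independent S" "B \<subseteq> cspan S"
    using complex_vec.maximal_independent_subset[of B] by blast
  have spanS: "cspan S = cspan B"
    using S by (metis complex_vec.span_minimal complex_vec.span_mono complex_vec.subspace_span subset_antisym)
  have finS: "finite S" using S(1) B by (rule finite_subset)
  have ind: "complex_vec.independent (g ` S)"
    using S(2) inj by (intro g.independent_injective_image) (simp_all add: spanS flip: cspan_def)
  have inj': "inj_on g S" using inj S(1) by (meson complex_vec.span_superset inj_on_subset subset_trans)
  have "v \<in> cspan (g ` S)" if v: "v \<in> cspan B" for v
  proof (rule ccontr)
    assume nv: "v \<notin> cspan (g ` S)"
    then have "complex_vec.independent (insert v (g ` S))"
      using ind by (simp add: complex_vec.independent_insert)
    moreover have "insert v (g ` S) \<subseteq> cspan S"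
      unfolding spanS using v into S(1) complex_vec.span_superset[of B] by blast
    ultimately have "card (insert v (g ` S)) \<le> card S"
      by (rule complex_vec.independent_span_bound[OF finS, THEN conjunct2])
    moreover have "v \<notin> g ` S" by (rule contra_subsetD[OF complex_vec.span_superset nv])
    ultimately show False using finS by (simp add: card_image[OF inj'])
  qed
  then have "cspan B \<subseteq> g ` cspan B"
    using g.span_image[of S] by (auto simp: spanS simp flip: cspan_def)
  then show ?thesis using into by blast
qed

text \<open>Compressed to the finite-dimensional range of \<open>P n\<close>, an operator that is bounded below is
  invertible, so its adjoint has the same lower bound there.\<close>

lemma quasitriangular_adjoint_bounded_below:
  fixes A :: "'a::complex_hilbert_space \<Rightarrow> 'a" and P :: "nat \<Rightarrow> 'a \<Rightarrow> 'a"
  assumes A: "bounded_clinear A" and P: "\<And>n. orthogonal_projection (P n)" "\<And>n. finite_cdim (range (P n))"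
      "\<And>x. (\<lambda>n. P n x) \<longlonglongrightarrow> x"
    and d: "d \<longlonglongrightarrow> 0" "\<And>n x. norm (A (P n x) - P n (A (P n x))) \<le> d n * norm x"
    and below: "\<And>x. c * norm x \<le> norm (A x)" and c: "0 < c"
    and y: "\<And>x. cmod (cinner (A x) y) \<le> r * norm x * norm y" and r: "r < c"
  shows "y = 0"
proof -
  note PD = orthogonal_projectionD[OF P(1)]
  obtain M where M: "\<And>x. norm (A x) \<le> norm x * M" "M > 0"
    using bounded_linear.pos_bounded[OF bounded_clinearD(1)[OF A]] by blast
  have ev: "eventually (\<lambda>n. d n < c) sequentially" using order_tendstoD(2)[OF d(1) c] .
  have main: "(c - d n) * (norm (P n y))\<^sup>2 \<le> norm (P n y) * (r * norm y + M * norm (y - P n y))" if dn: "d n < c" for n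
  proof -
    \<comment> \<open>On its range, \<open>P n\<close> moves \<open>A z\<close> by at most
      \<open>d n * norm z\<close>, so the compression keeps the lower bound up to
      \<open>d n\<close>.\<close>
    have low: "(c - d n) * norm z \<le> norm (P n (A z))" if "z \<in> range (P n)" for z
    proof -
      have z: "P n z = z" using that by (rule PD(4))
      have "norm (A z) \<le> norm (P n (A z)) + norm (A z - P n (A z))" by (rule norm_triangle_sub)
      then show ?thesis using below[of z] d(2)[of n z] by (simp add: z algebra_simps)
    qed
    obtain B where B: "finite B" "cspan B = range (P n)" using P(2)[of n] unfolding finite_cdim_def by blast
    let ?g = "\<lambda>x. P n (A x)"
    have g: "bounded_clinear ?g" by (intro bounded_clinear_compose[OF PD(1)] A)
    have "inj_on ?g (cspan B)"
    proof (rule inj_onI)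
      fix a b assume ab: "a \<in> cspan B" "b \<in> cspan B" "?g a = ?g b"
      have "a - b \<in> range (P n)" using ab B(2) complex_vec.span_diff by blast
      from low[OF this] have "(c - d n) * norm (a - b) \<le> 0"
        using bounded_clinearD(4)[OF g] ab(3) by simp
      then show "a = b" using dn by (simp add: mult_le_0_iff)
    qed
    then have "?g ` cspan B = cspan B"
      using B g by (intro finite_cdim_surj) auto
    then have "P n y \<in> ?g ` cspan B" using B(2) by blast
    \<comment> \<open>Testing \<open>y\<close> against the preimage \<open>z\<close> of
      \<open>P n y\<close> under the compression turns the smallness of the adjoint at
      \<open>y\<close> into a bound on \<open>P n y\<close>; \<open>low\<close> bounds
      \<open>norm z\<close>.\<close>
    then obtain z where z: "z \<in> range (P n)" "P n y = P n (A z)" using B(2) by auto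
    have "complex_of_real ((norm (P n y))\<^sup>2) = cinner (P n (A z)) (P n y)"
      using z(2) by (simp add: cinner_self)
    also have "\<dots> = cinner (A z) (P n y)" by (simp add: PD(2,3))
    also have "\<dots> = cinner (A z) y - cinner (A z) (y - P n y)" by (simp add: cinner_diff_right)
    finally have "(norm (P n y))\<^sup>2 = cmod (cinner (A z) y - cinner (A z) (y - P n y))"
      by (metis abs_of_nonneg norm_of_real zero_le_power2)
    also have "\<dots> \<le> cmod (cinner (A z) y) + cmod (cinner (A z) (y - P n y))" by (rule norm_triangle_ineq4)
    also have "\<dots> \<le> r * norm z * norm y + (norm z * M) * norm (y - P n y)"
      using y[of z] cinner_norm_le[of "A z" "y - P n y"] M(1)[of z]
      by (intro add_mono) (meson mult_right_mono norm_ge_zero order_trans)+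
    also have "\<dots> = norm z * (r * norm y + M * norm (y - P n y))" by (simp add: algebra_simps)
    finally have 1: "(norm (P n y))\<^sup>2 \<le> norm z * (r * norm y + M * norm (y - P n y))" .
    show ?thesis
    proof (cases "P n y = 0")
      case False
      then have pos: "0 \<le> r * norm y + M * norm (y - P n y)"
        using 1 by (smt (verit) mult_nonneg_nonpos norm_ge_zero zero_less_norm_iff zero_less_power)
      have "(c - d n) * (norm (P n y))\<^sup>2 \<le> ((c - d n) * norm z) * (r * norm y + M * norm (y - P n y))"
        using mult_left_mono[OF 1, of "c - d n"] dn by (simp add: mult.assoc)
      also have "\<dots> \<le> norm (P n y) * (r * norm y + M * norm (y - P n y))"
        using low[OF z(1)] z(2) pos by (intro mult_right_mono) auto
      finally show ?thesis .
    qed simp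
  qed
  \<comment> \<open>In the limit \<open>main\<close> reads c |y|^2 \<le> r |y|^2, contradicting
    \<open>r < c\<close> unless \<open>y\<close> vanishes.\<close>
  have "(c - 0) * (norm y)\<^sup>2 \<le> norm y * (r * norm y + M * norm (y - y))"
  proof (rule tendsto_le[OF sequentially_bot])
    show "(\<lambda>n. norm (P n y) * (r * norm y + M * norm (y - P n y))) \<longlonglongrightarrow> norm y * (r * norm y + M * norm (y - y))"
      by (intro tendsto_intros P(3))
    show "(\<lambda>n. (c - d n) * (norm (P n y))\<^sup>2) \<longlonglongrightarrow> (c - 0) * (norm y)\<^sup>2"
      by (intro tendsto_intros P(3) d(1))
    show "eventually (\<lambda>n. (c - d n) * (norm (P n y))\<^sup>2 \<le> norm (P n y) * (r * norm y + M * norm (y - P n y))) sequentially"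
      using ev by eventually_elim (rule main)
  qed
  then have "(c - r) * (norm y)\<^sup>2 \<le> 0" by (simp add: power2_eq_square algebra_simps)
  then show ?thesis using r by (simp add: mult_le_0_iff)
qed

text \<open>The scalar commutes with \<open>P n\<close>, and each rank-one term contributes an error
  proportional to \<open>v i - P n (v i)\<close>, which tends to 0. So \<open>A\<close> inherits the
  asymptotic invariance of \<open>T\<close>.\<close>

lemma quasitriangular_finite_rank_perturbation:
  fixes T :: "'a::complex_hilbert_space \<Rightarrow> 'a" and f v :: "'i \<Rightarrow> 'a"
  assumes T: "bounded_clinear T" and qt: "quasitriangular T" and I: "finite I"
    and A: "\<And>x. A x = T x - b *\<^sub>C x - (\<Sum>i\<in>I. cinner x (f i) *\<^sub>C v i)"
    and below: "\<And>x. c * norm x \<le> norm (A x)" and c: "0 < c"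
    and y: "\<And>x. cmod (cinner (A x) y) \<le> r * norm x * norm y" and r: "r < c"
  shows "y = 0"
proof -
  obtain P :: "nat \<Rightarrow> 'a \<Rightarrow> 'a" where P: "\<And>n. orthogonal_projection (P n)" "\<And>n. finite_cdim (range (P n))"
      "\<And>x. (\<lambda>n. P n x) \<longlonglongrightarrow> x" "(\<lambda>n. onorm (\<lambda>x. T (P n x) - P n (T (P n x)))) \<longlonglongrightarrow> 0"
    using qt unfolding quasitriangular_def by blast
  note PD = orthogonal_projectionD[OF P(1)]
  define d where "d n = onorm (\<lambda>x. T (P n x) - P n (T (P n x))) + (\<Sum>i\<in>I. norm (f i) * norm (v i - P n (v i)))" for n
  have bA: "bounded_clinear A"
    unfolding A[abs_def] by (intro bounded_clinear_diff bounded_clinear_scaleC bounded_clinear_ident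
        bounded_clinear_sum_fun bounded_clinear_rank_one T)
  have "d \<longlonglongrightarrow> 0 + (\<Sum>i\<in>I. norm (f i) * norm (v i - v i))"
    unfolding d_def[abs_def] by (intro tendsto_intros P)
  then have d: "d \<longlonglongrightarrow> 0" by simp
  have "norm (A (P n x) - P n (A (P n x))) \<le> d n * norm x" for n x
  proof -
    have "A (P n x) - P n (A (P n x)) = (T (P n x) - P n (T (P n x)))
        - (\<Sum>i\<in>I. cinner (P n x) (f i) *\<^sub>C (v i - P n (v i)))"
      by (simp add: A bounded_clinearD(2,4)[OF PD(1)] bounded_clinear_sum[OF PD(1)] PD(2) sum_subtractf
          complex_vec.scale_right_diff_distrib)
    also have "norm \<dots> \<le> norm (T (P n x) - P n (T (P n x)))
        + norm (\<Sum>i\<in>I. cinner (P n x) (f i) *\<^sub>C (v i - P n (v i)))" by (rule norm_triangle_ineq4)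
    also have "\<dots> \<le> onorm (\<lambda>x. T (P n x) - P n (T (P n x))) * norm x
        + (\<Sum>i\<in>I. norm (f i) * norm (v i - P n (v i)) * norm x)"
    proof (intro add_mono norm_sum[THEN order_trans] sum_mono)
      have "bounded_linear (\<lambda>x. T (P n x) - P n (T (P n x)))"
        by (intro bounded_clinearD(1) bounded_clinear_diff bounded_clinear_compose[OF T]
            bounded_clinear_compose[OF PD(1)] PD(1) T)
      then show "norm (T (P n x) - P n (T (P n x))) \<le> onorm (\<lambda>x. T (P n x) - P n (T (P n x))) * norm x"
        by (rule onorm)
      fix i
      have "cmod (cinner (P n x) (f i)) \<le> norm (P n x) * norm (f i)" by (rule cinner_norm_le)
      also have "\<dots> \<le> norm x * norm (f i)"
        by (intro mult_right_mono orthogonal_projection_norm_le P(1)) simp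
      finally have "cmod (cinner (P n x) (f i)) * norm (v i - P n (v i)) \<le> norm x * norm (f i) * norm (v i - P n (v i))"
        by (rule mult_right_mono) simp
      then show "norm (cinner (P n x) (f i) *\<^sub>C (v i - P n (v i))) \<le> norm (f i) * norm (v i - P n (v i)) * norm x"
        by (simp add: norm_scaleC mult_ac)
    qed
    finally show ?thesis by (simp add: d_def distrib_right sum_distrib_right)
  qed
  then show ?thesis
    using quasitriangular_adjoint_bounded_below[OF bA P(1-3) d _ below c y r] by blast
qed

section \<open>Tridiagonal operators\<close>

lemma orthonormal_basisD:
  fixes e :: "nat \<Rightarrow> 'a::complex_inner"
  assumes "orthonormal_basis e"
  shows "cinner (e m) (e n) = (if m = n then 1 else 0)" "norm (e n) = 1"
proof -
  show *: "cinner (e m) (e n) = (if m = n then 1 else 0)" for m n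
    using assms by (simp add: orthonormal_basis_def)
  have "(norm (e n))\<^sup>2 = 1" using *[of n n] by (simp add: cinner_self flip: of_real_power)
  then show "norm (e n) = 1" by (simp add: power2_eq_1_iff) (metis norm_ge_zero not_one_le_zero neg_0_le_iff_le)
qed

text \<open>Finite combinations are dense; closed conditions on vectors can thus be checked without
  infinite series.\<close>

lemma orthonormal_basis_closed_induct:
  fixes e :: "nat \<Rightarrow> 'a::complex_inner"
  assumes e: "orthonormal_basis e" and S: "closed S"
    and fin: "\<And>(n::nat) c. (\<Sum>i<n. c i *\<^sub>C e i) \<in> S"
  shows "x \<in> S"
proof -
  have inj: "inj e" using orthonormal_basisD(1)[OF e] by (metis injI zero_neq_one)
  have "x \<in> closure S"
    unfolding closure_approachable
  proof (intro allI impI)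
    fix r :: real assume "0 < r"
    then obtain n y where y: "y \<in> cspan (e ` {..<n})" "norm (x - y) < r"
      using orthonormal_basis_approx[OF e] by blast
    then obtain c where "y = (\<Sum>v\<in>e ` {..<n}. c v *\<^sub>C v)"
      using complex_vec.span_finite[of "e ` {..<n}"] by auto
    then have "y = (\<Sum>i<n. c (e i) *\<^sub>C e i)"
      by (simp add: sum.reindex inj_on_subset[OF inj])
    then have "y \<in> S" using fin by simp
    then show "\<exists>y\<in>S. dist y x < r" using y(2) by (auto simp: dist_norm norm_minus_commute)
  qed
  then show ?thesis using S by simp
qed

lemma orthonormal_basis_eqI:
  fixes e :: "nat \<Rightarrow> 'a::complex_inner"
  assumes e: "orthonormal_basis e" and eq: "\<And>n. cinner x (e n) = cinner y (e n)"
  shows "x = y"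
proof (rule cinner_eqI)
  fix z
  have "z \<in> {z. cinner z x = cinner z y}"
  proof (rule orthonormal_basis_closed_induct[OF e])
    show "closed {z. cinner z x = cinner z y}"
      by (intro closed_Collect_eq linear_continuous_on bounded_linear_cinner_left)
    have "cinner (e n) x = cinner (e n) y" for n using eq[of n] by (metis cinner_commute)
    then show "(\<Sum>i<n. c i *\<^sub>C e i) \<in> {z. cinner z x = cinner z y}" for n :: nat and c
      by (simp add: cinner_sum_left cinner_scaleC_left)
  qed
  then show "cinner z x = cinner z y" by simp
qed

lemma orthonormal_norm_sum:
  fixes e :: "nat \<Rightarrow> 'a::complex_inner"
  assumes e: "orthonormal_basis e" and p: "inj_on p I" and I: "finite I"
  shows "(norm (\<Sum>i\<in>I. c i *\<^sub>C e (p i)))\<^sup>2 = (\<Sum>i\<in>I. (cmod (c i))\<^sup>2)"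
proof -
  let ?x = "\<Sum>i\<in>I. c i *\<^sub>C e (p i)"
  have "cinner ?x ?x = (\<Sum>i\<in>I. \<Sum>j\<in>I. if i = j then c i * cnj (c i) else 0)"
    using inj_onD[OF p]
    by (auto simp: cinner_sum_left cinner_sum_right cinner_scaleC_left cinner_scaleC_right orthonormal_basisD(1)[OF e]
        sum_distrib_left intro!: sum.cong)
  also have "\<dots> = (\<Sum>i\<in>I. c i * cnj (c i))" using I by simp
  also have "\<dots> = complex_of_real (\<Sum>i\<in>I. (cmod (c i))\<^sup>2)"
    by (simp only: of_real_sum complex_norm_square)
  finally show ?thesis by (simp only: cinner_self of_real_eq_iff)
qed

text \<open>An upper bound for a weighted shift with weights \<open>s\<close> and index map
  \<open>p\<close>. The index set \<open>I\<close> is free because truncated subtraction, used as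
  \<open>p\<close>, is not injective at 0.\<close>

lemma orthonormal_norm_sum_le:
  fixes e :: "nat \<Rightarrow> 'a::complex_inner"
  assumes e: "orthonormal_basis e" and p: "inj_on p I" and I: "I \<subseteq> {..<n}"
    and s: "\<And>i. i \<in> I \<Longrightarrow> cmod (s i) \<le> r" and r: "0 \<le> r"
  shows "norm (\<Sum>i\<in>I. (s i * c i) *\<^sub>C e (p i)) \<le> r * norm (\<Sum>i<n. c i *\<^sub>C e i)"
proof -
  have fin: "finite I" using I finite_subset by blast
  have "(norm (\<Sum>i\<in>I. (s i * c i) *\<^sub>C e (p i)))\<^sup>2 = (\<Sum>i\<in>I. (cmod (s i) * cmod (c i))\<^sup>2)"
    by (simp add: orthonormal_norm_sum[OF e p fin] norm_mult)
  also have "\<dots> \<le> (\<Sum>i\<in>I. (r * cmod (c i))\<^sup>2)"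
    by (intro sum_mono power_mono mult_right_mono s) auto
  also have "\<dots> \<le> (\<Sum>i<n. (r * cmod (c i))\<^sup>2)" using I by (intro sum_mono2) auto
  also have "\<dots> = (r * norm (\<Sum>i<n. c i *\<^sub>C e i))\<^sup>2"
    using orthonormal_norm_sum[OF e, of "\<lambda>i. i" "{..<n}" c] by (simp add: power_mult_distrib sum_distrib_left)
  finally show ?thesis using r by (meson mult_nonneg_nonneg norm_ge_zero power2_le_imp_le)
qed

lemma orthonormal_norm_sum_ge:
  fixes e :: "nat \<Rightarrow> 'a::complex_inner"
  assumes e: "orthonormal_basis e" and p: "inj_on p {..<n}"
    and s: "\<And>i. r \<le> cmod (s i)" and r: "0 \<le> r"
  shows "r * norm (\<Sum>i<n. c i *\<^sub>C e i) \<le> norm (\<Sum>i<n. (s i * c i) *\<^sub>C e (p i))"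
proof -
  have "(r * norm (\<Sum>i<n. c i *\<^sub>C e i))\<^sup>2 = (\<Sum>i<n. (r * cmod (c i))\<^sup>2)"
    using orthonormal_norm_sum[OF e, of "\<lambda>i. i" "{..<n}" c] by (simp add: power_mult_distrib sum_distrib_left)
  also have "\<dots> \<le> (\<Sum>i<n. (cmod (s i) * cmod (c i))\<^sup>2)"
    using r by (intro sum_mono power_mono mult_right_mono s) auto
  also have "\<dots> = (norm (\<Sum>i<n. (s i * c i) *\<^sub>C e (p i)))\<^sup>2"
    by (simp add: orthonormal_norm_sum[OF e p] norm_mult)
  finally show ?thesis by (rule power2_le_imp_le) simp
qed

section \<open>Matrix entries and the self-commutator\<close>

locale tridiagonal_op =
  fixes T :: "'a::complex_hilbert_space \<Rightarrow> 'a" and e :: "nat \<Rightarrow> 'a"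
  assumes T: "bounded_clinear T" and e: "orthonormal_basis e" and tri: "tridiagonal e T"
begin

definition upper :: "nat \<Rightarrow> complex" where "upper n = cinner (T (e (Suc n))) (e n)"
definition diagonal :: "nat \<Rightarrow> complex" where "diagonal n = cinner (T (e n)) (e n)"
definition lower :: "nat \<Rightarrow> complex" where "lower n = cinner (T (e n)) (e (Suc n))"

text \<open>The sesquilinear form of the self-commutator, with no product of operators, so that the
  columns of \<open>T\<close> and of its adjoint suffice to compute it.\<close>

definition self_comm :: "'a \<Rightarrow> 'a \<Rightarrow> complex"
  where "self_comm x y = cinner (T x) (T y) - cinner (cadjoint T x) (cadjoint T y)"

abbreviation "defect n \<equiv> Re (self_comm (e n) (e n))"

lemma entry: "cinner (T (e n)) (e m) =
    (if m = n then diagonal n else if m = Suc n then lower n else if n = Suc m then upper m else 0)"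
proof -
  have "cinner (T (e n)) (e m) = 0" if "m \<noteq> n" "m \<noteq> Suc n" "n \<noteq> Suc m"
    using tri that unfolding tridiagonal_def by (smt (verit) int_ops(4) of_nat_eq_iff of_nat_0_le_iff)
  then show ?thesis by (auto simp: upper_def diagonal_def lower_def)
qed

lemma adj_entry: "cinner (cadjoint T (e n)) (e m) = cnj (cinner (T (e m)) (e n))"
  by (metis cadjoint_works'[OF T] cinner_commute)

lemma T_0: "T (e 0) = diagonal 0 *\<^sub>C e 0 + lower 0 *\<^sub>C e (Suc 0)"
  by (rule orthonormal_basis_eqI[OF e]) (auto simp: entry cinner_simps orthonormal_basisD(1)[OF e])

lemma T_Suc: "T (e (Suc n)) = upper n *\<^sub>C e n + diagonal (Suc n) *\<^sub>C e (Suc n) + lower (Suc n) *\<^sub>C e (Suc (Suc n))"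
  by (rule orthonormal_basis_eqI[OF e]) (auto simp: entry cinner_simps orthonormal_basisD(1)[OF e])

lemma adj_0: "cadjoint T (e 0) = cnj (diagonal 0) *\<^sub>C e 0 + cnj (upper 0) *\<^sub>C e (Suc 0)"
  by (rule orthonormal_basis_eqI[OF e]) (auto simp: entry adj_entry cinner_simps orthonormal_basisD(1)[OF e])

lemma adj_Suc: "cadjoint T (e (Suc n)) =
    cnj (lower n) *\<^sub>C e n + cnj (diagonal (Suc n)) *\<^sub>C e (Suc n) + cnj (upper (Suc n)) *\<^sub>C e (Suc (Suc n))"
  by (rule orthonormal_basis_eqI[OF e]) (auto simp: entry adj_entry cinner_simps orthonormal_basisD(1)[OF e])

text \<open>The diagonal entries of \<open>T\<close> cancel, and \<open>defect (Suc n)\<close> is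
  the increment of |l|^2 - |u|^2 from n to n + 1.\<close>

lemma sum_defect: "(\<Sum>i\<le>n. defect i) = (cmod (lower n))\<^sup>2 - (cmod (upper n))\<^sup>2"
proof (induction n)
  case 0
  have "self_comm (e 0) (e 0) = lower 0 * cnj (lower 0) - upper 0 * cnj (upper 0)"
    unfolding self_comm_def
    \<comment> \<open>Only the second arguments are expanded; the first ones are left for
      \<open>entry\<close> and \<open>adj_entry\<close>.\<close>
    by (subst (2) T_0, subst (2) adj_0) (simp add: cinner_simps entry adj_entry algebra_simps)
  then show ?case by (simp add: flip: complex_norm_square of_real_power)
next
  case (Suc n)
  have "self_comm (e (Suc n)) (e (Suc n)) = upper n * cnj (upper n) + lower (Suc n) * cnj (lower (Suc n))
      - lower n * cnj (lower n) - upper (Suc n) * cnj (upper (Suc n))"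
    unfolding self_comm_def
    by (subst (2) T_Suc, subst (2) adj_Suc) (simp add: cinner_simps entry adj_entry algebra_simps)
  then show ?case using Suc by (simp add: flip: complex_norm_square of_real_power)
qed

text \<open>The modulus of this entry is at least the gap between |l| and |u| times the diagonal
  increment, so it controls that increment.\<close>

lemma self_comm_Suc: "self_comm (e n) (e (Suc n)) =
    cnj (upper n) * (diagonal n - diagonal (Suc n)) - lower n * cnj (diagonal n - diagonal (Suc n))"
  unfolding self_comm_def T_Suc adj_Suc by (simp add: cinner_simps entry adj_entry algebra_simps)

text \<open>Up to phases, this is the numerator of the increment of the ratio |u| / |l|.\<close>

lemma self_comm_Suc_Suc: "self_comm (e n) (e (Suc (Suc n))) =
    lower n * cnj (upper (Suc n)) - lower (Suc n) * cnj (upper n)"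
  unfolding self_comm_def T_Suc adj_Suc by (simp add: cinner_simps entry adj_entry algebra_simps)

lemma self_comm_commutator:
  "cinner (commutator (cadjoint T) T x) y = self_comm x y"
proof -
  have "cinner (T (cadjoint T x)) y = cinner (cadjoint T x) (cadjoint T y)"
    by (rule cadjoint_works[OF T])
  then show ?thesis by (simp add: commutator_def self_comm_def cinner_diff_left cadjoint_works'[OF T])
qed

end

section \<open>Convergence of the entries under hyponormality\<close>

locale tridiagonal_hyponormal = tridiagonal_op +
  assumes hypo: "hyponormal T"
begin

lemma self_comm_nonneg: "0 \<le> Re (self_comm x x)"
  using hypo unfolding hyponormal_def positive_semidefinite_def self_comm_commutator by blast

text \<open>Positivity of the form on the span of two vectors. The arithmetic mean is used because
  it is directly summable along the basis.\<close>

lemma self_comm_bound: "cmod (self_comm x y) \<le> (Re (self_comm x x) + Re (self_comm y y)) / 2"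
proof (cases "self_comm x y = 0")
  case True
  then show ?thesis using self_comm_nonneg[of x] self_comm_nonneg[of y] by simp
next
  case False
  \<comment> \<open>With this phase the two cross terms at \<open>x + w *\<^sub>C y\<close> add up
    to minus twice the modulus.\<close>
  define w where "w = - sgn (self_comm x y)"
  have w: "w * cnj w = 1" using False by (simp add: w_def complex_norm_square[symmetric] norm_sgn)
  have conj: "self_comm y x = cnj (self_comm x y)"
    by (simp add: self_comm_def flip: cinner_commute)
  have "cnj w * self_comm x y = - complex_of_real (cmod (self_comm x y))"
    using False by (simp add: w_def sgn_eq complex_norm_square[symmetric] mult.commute power2_eq_square)
  then have "Re (cnj w * self_comm x y) = - cmod (self_comm x y)" by simp
  moreover have "Re (w * self_comm y x) = Re (cnj w * self_comm x y)"
    by (simp add: conj)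
  moreover have "self_comm (x + w *\<^sub>C y) (x + w *\<^sub>C y) =
      self_comm x x + cnj w * self_comm x y + w * self_comm y x + (w * cnj w) * self_comm y y"
    by (simp add: self_comm_def bounded_clinearD[OF T] bounded_clinearD[OF bounded_clinear_cadjoint[OF T]]
        cinner_simps algebra_simps)
  ultimately show ?thesis using self_comm_nonneg[of "x + w *\<^sub>C y"] by (simp add: w)
qed

lemma normal_if_no_defect:
  assumes "\<And>n. defect n = 0"
  shows "normal_operator T"
proof -
  have z: "self_comm (e i) (e j) = 0" for i j
    using self_comm_bound[of "e i" "e j"] assms by simp
  have 1: "commutator (cadjoint T) T (e i) = 0" for i
    by (rule orthonormal_basis_eqI[OF e]) (simp add: self_comm_commutator z)
  have b: "bounded_clinear (commutator (cadjoint T) T)"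
    unfolding commutator_def using T bounded_clinear_cadjoint[OF T]
    by (intro bounded_clinear_diff) (auto intro: bounded_clinear_compose)
  have "x \<in> {x. commutator (cadjoint T) T x = 0}" for x
  proof (rule orthonormal_basis_closed_induct[OF e])
    show "closed {x. commutator (cadjoint T) T x = 0}"
      by (intro closed_Collect_eq linear_continuous_on bounded_clinearD(1)[OF b] continuous_on_const)
  qed (simp add: bounded_clinear_sum[OF b] bounded_clinearD[OF b] 1)
  then show ?thesis by (auto simp: normal_operator_def commutator_def fun_eq_iff)
qed

text \<open>The self-commutator entries near the diagonal are summable, hence so are the increments
  of \<open>diagonal\<close> and of the ratio |u| / |l|. The limits of this ratio and of |l|^2 -
  |u|^2 then determine those of |l| and |u|.\<close>

lemma entries_converge:
  assumes "\<not> normal_operator T"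
  obtains b p q where "diagonal \<longlonglongrightarrow> b" "(\<lambda>n. cmod (lower n)) \<longlonglongrightarrow> p" "(\<lambda>n. cmod (upper n)) \<longlonglongrightarrow> q" "q < p" "0 \<le> q"
proof -
  obtain i0 where i0: "0 < defect i0"
    using assms normal_if_no_defect self_comm_nonneg by (metis order_le_less)
  define D where "D = defect i0"
  have D: "0 < D" using i0 by (simp add: D_def)
  obtain M where M: "\<And>x. norm (T x) \<le> norm x * M" "M > 0"
    using bounded_linear.pos_bounded[OF bounded_clinearD(1)[OF T]] by blast
  have lM: "cmod (lower n) \<le> M" for n
    using cinner_norm_le[of "T (e n)" "e (Suc n)"] M(1)[of "e n"]
    by (simp add: lower_def orthonormal_basisD(2)[OF e])
  have mono: "(\<Sum>i\<le>m. defect i) \<le> (\<Sum>i\<le>n. defect i)" if "m \<le> n" for m n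
    using that self_comm_nonneg by (intro sum_mono2) auto
  have "summable (\<lambda>n. defect n)"
  proof (rule bounded_imp_summable)
    show "(\<Sum>i\<le>n. defect i) \<le> M\<^sup>2" for n
      using power_mono[OF lM[of n], of 2] by (simp add: sum_defect add_increasing2 diff_le_eq)
  qed (rule self_comm_nonneg)
  note sd = this
  have sS: "summable (\<lambda>n. defect (n + k))" for k using summable_ignore_initial_segment[OF sd] .
  \<comment> \<open>The partial sums increase, so a single positive defect keeps |l|^2 - |u|^2 away
    from 0 from \<open>i0\<close> on.\<close>
  have gap: "D \<le> (cmod (lower n))\<^sup>2 - (cmod (upper n))\<^sup>2" if "i0 \<le> n" for n
  proof -
    have "D \<le> (\<Sum>i\<le>i0. defect i)"
      unfolding D_def by (rule member_le_sum) (auto intro: self_comm_nonneg)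
    also have "\<dots> \<le> (\<Sum>i\<le>n. defect i)" using that by (rule mono)
    finally show ?thesis by (simp add: sum_defect)
  qed
  have ul: "cmod (upper n) \<le> cmod (lower n)" for n
  proof -
    have "0 \<le> (\<Sum>i\<le>n. defect i)" by (intro sum_nonneg self_comm_nonneg)
    then have "(cmod (upper n))\<^sup>2 \<le> (cmod (lower n))\<^sup>2" by (simp add: sum_defect)
    then show ?thesis by (rule power2_le_imp_le) simp
  qed
  have lD: "sqrt D \<le> cmod (lower n)" if "i0 \<le> n" for n
  proof (rule real_le_lsqrt)
    show "D \<le> (cmod (lower n))\<^sup>2"
      using gap[OF that] zero_le_power2[of "cmod (upper n)"] by linarith
  qed simp
  have gap1: "D / (2 * M) \<le> cmod (lower n) - cmod (upper n)" if "i0 \<le> n" for n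
  proof -
    have "D \<le> (cmod (lower n) - cmod (upper n)) * (cmod (lower n) + cmod (upper n))"
      using gap[OF that] by (simp add: power2_eq_square algebra_simps)
    also have "\<dots> \<le> (cmod (lower n) - cmod (upper n)) * (2 * M)"
      using lM[of n] ul[of n] by (intro mult_left_mono) auto
    finally show ?thesis using M(2) by (simp add: field_simps)
  qed
  have conv: "convergent f" if "summable g" "\<And>n. i0 \<le> n \<Longrightarrow> norm (f (Suc n) - f n) \<le> g n"
    for f :: "nat \<Rightarrow> 'b::banach" and g
  proof -
    have "summable (\<lambda>n. f (Suc n) - f n)" using that by (rule summable_comparison_test'[of g i0])
    then have "convergent (\<lambda>n. (\<Sum>i<n. f (Suc i) - f i) + f 0)"
      by (intro convergent_add convergent_const) (simp add: summable_iff_convergent)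
    then show ?thesis by (simp add: sum_lessThan_telescope)
  qed
  have "convergent diagonal"
  proof (rule conv)
    \<comment> \<open>The constant is the half in \<open>self_comm_bound\<close> divided by the gap
      D / (2 M).\<close>
    show "summable (\<lambda>n. (M / D) * (defect n + defect (n + 1)))"
      by (intro summable_mult summable_add sS sd)
    fix n assume n: "i0 \<le> n"
    let ?x = "diagonal n - diagonal (Suc n)"
    have "D / (2 * M) * cmod ?x \<le> (cmod (lower n) - cmod (upper n)) * cmod ?x"
      by (intro mult_right_mono gap1 n) simp
    also have "\<dots> = cmod (lower n * cnj ?x) - cmod (cnj (upper n) * ?x)"
      by (simp only: norm_mult complex_mod_cnj left_diff_distrib)
    also have "\<dots> \<le> cmod (self_comm (e n) (e (Suc n)))"
      unfolding self_comm_Suc by (subst norm_minus_commute) (rule norm_triangle_ineq2)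
    also have "\<dots> \<le> (defect n + defect (Suc n)) / 2" by (rule self_comm_bound)
    finally show "cmod (diagonal (Suc n) - diagonal n) \<le> (M / D) * (defect n + defect (n + 1))"
      using D M(2) by (simp add: field_simps norm_minus_commute)
  qed
  then obtain b where b: "diagonal \<longlonglongrightarrow> b" by (auto simp: convergent_def)
  define t where "t n = cmod (upper n) / cmod (lower n)" for n
  have "convergent t"
  proof (rule conv)
    show "summable (\<lambda>n. (defect n + defect (n + 2)) / (2 * D))"
      by (intro summable_divide summable_add sS sd)
    fix n assume n: "i0 \<le> n"
    let ?l = "cmod (lower n)" and ?l' = "cmod (lower (Suc n))" and ?u = "cmod (upper n)" and ?u' = "cmod (upper (Suc n))"
    have l: "0 < sqrt D" "sqrt D \<le> ?l" "sqrt D \<le> ?l'" using D lD[OF n] lD[of "Suc n"] n by auto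
    then have pos: "0 < ?l" "0 < ?l'" by linarith+
    have ll: "D \<le> ?l * ?l'"
      using mult_mono[OF l(2,3)] l(1) D by simp
    \<comment> \<open>The reverse triangle inequality removes the phases from the entry two off the
      diagonal; the denominator is at least \<open>D\<close>.\<close>
    have "\<bar>t (Suc n) - t n\<bar> = \<bar>?l * ?u' - ?l' * ?u\<bar> / (?l * ?l')"
      using pos unfolding t_def by (simp add: diff_frac_eq abs_mult mult.commute)
    also have "\<dots> \<le> \<bar>?l * ?u' - ?l' * ?u\<bar> / D"
      using ll D by (intro divide_left_mono) (auto intro: mult_pos_pos)
    also have "\<bar>?l * ?u' - ?l' * ?u\<bar> \<le> cmod (self_comm (e n) (e (Suc (Suc n))))"
      unfolding self_comm_Suc_Suc
      using norm_triangle_ineq3[of "lower n * cnj (upper (Suc n))" "lower (Suc n) * cnj (upper n)"]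
      by (simp add: norm_mult)
    also have "\<dots> \<le> (defect n + defect (Suc (Suc n))) / 2" by (rule self_comm_bound)
    finally show "norm (t (Suc n) - t n) \<le> (defect n + defect (n + 2)) / (2 * D)"
      using D by (simp add: divide_right_mono)
  qed
  then obtain s where s: "t \<longlonglongrightarrow> s" by (auto simp: convergent_def)
  have s0: "0 \<le> s" by (rule LIMSEQ_le_const[OF s]) (auto simp: t_def)
  have tl: "1 - (t n)\<^sup>2 = (\<Sum>i\<le>n. defect i) / (cmod (lower n))\<^sup>2" if "i0 \<le> n" for n
  proof -
    have "cmod (lower n) > 0" using lD[OF that] D by (meson less_le_trans real_sqrt_gt_zero)
    then show ?thesis by (simp add: sum_defect t_def power_divide diff_divide_distrib)
  qed
  have lsq: "0 < (cmod (lower n))\<^sup>2 \<and> (cmod (lower n))\<^sup>2 \<le> M\<^sup>2" if "i0 \<le> n" for n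
    using gap[OF that] D power_mono[OF lM[of n], of 2] by (smt (verit) norm_ge_zero zero_le_power2)
  \<comment> \<open>The limit ratio stays strictly below 1, which permits solving 1 - t^2 = (partial
    sum) / |l|^2 for |l|.\<close>
  have "D / M\<^sup>2 \<le> 1 - s\<^sup>2"
  proof (rule LIMSEQ_le_const)
    show "(\<lambda>n. 1 - (t n)\<^sup>2) \<longlonglongrightarrow> 1 - s\<^sup>2" by (intro tendsto_intros s)
    have "D / M\<^sup>2 \<le> 1 - (t n)\<^sup>2" if "i0 \<le> n" for n
      unfolding tl[OF that] using gap[OF that] lsq[OF that] D ul[of n] by (intro frac_le) (auto simp: sum_defect)
    then show "\<exists>N. \<forall>n\<ge>N. D / M\<^sup>2 \<le> 1 - (t n)\<^sup>2" by blast
  qed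
  then have s1: "0 < 1 - s\<^sup>2" using D M(2) by (smt (verit) divide_pos_pos zero_less_power)
  then have s_lt: "s < 1" by (smt (verit) one_power2 power_mono)
  define L where "L = (\<Sum>n. defect n)"
  have "(\<lambda>n. \<Sum>i\<le>n. defect i) \<longlonglongrightarrow> L" unfolding L_def using sd by (rule summable_LIMSEQ')
  then have "(\<lambda>n. sqrt ((\<Sum>i\<le>n. defect i) / (1 - (t n)\<^sup>2))) \<longlonglongrightarrow> sqrt (L / (1 - s\<^sup>2))"
    using s1 by (intro tendsto_intros s) auto
  moreover have "eventually (\<lambda>n. sqrt ((\<Sum>i\<le>n. defect i) / (1 - (t n)\<^sup>2)) = cmod (lower n)) sequentially"
    unfolding eventually_sequentially
  proof (intro exI allI impI)
    fix n assume n: "i0 \<le> n"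
    have "(\<Sum>i\<le>n. defect i) \<noteq> 0" using gap[OF n] D by (auto simp: sum_defect)
    then show "sqrt ((\<Sum>i\<le>n. defect i) / (1 - (t n)\<^sup>2)) = cmod (lower n)"
      unfolding tl[OF n] using lsq[OF n] by (simp del: sum.atMost_Suc)
  qed
  ultimately have lim_l: "(\<lambda>n. cmod (lower n)) \<longlonglongrightarrow> sqrt (L / (1 - s\<^sup>2))"
    by (rule Lim_transform_eventually)
  let ?p = "sqrt (L / (1 - s\<^sup>2))"
  have "(\<lambda>n. t n * cmod (lower n)) \<longlonglongrightarrow> s * ?p" by (intro tendsto_mult s lim_l)
  moreover have "eventually (\<lambda>n. t n * cmod (lower n) = cmod (upper n)) sequentially"
    unfolding eventually_sequentially
  proof (intro exI allI impI)
    fix n assume n: "i0 \<le> n"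
    show "t n * cmod (lower n) = cmod (upper n)" using lsq[OF n] by (auto simp: t_def)
  qed
  ultimately have lim_u: "(\<lambda>n. cmod (upper n)) \<longlonglongrightarrow> s * ?p" by (rule Lim_transform_eventually)
  have "sqrt D \<le> ?p" by (rule LIMSEQ_le_const[OF lim_l]) (use lD in blast)
  then have p: "0 < ?p" using D by (meson less_le_trans real_sqrt_gt_zero)
  show thesis
    by (rule that[OF b lim_l lim_u]) (use p s0 s_lt in auto)
qed

end

section \<open>The index obstruction\<close>

context tridiagonal_op
begin

text \<open>A finite-rank perturbation \<open>A\<close> of \<open>T - b\<close> splits at \<open>N\<close> into a scalar block and a tail dominated
  by the weighted forward shift with weights \<open>lower n\<close>; the tail is bounded below, while the finite vector
  \<open>y\<close> with coefficients \<open>Y k\<close> at \<open>e (N + 2 * k)\<close> almost annihilates its range.\<close>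

lemma not_quasitriangular_if_lower_dominates:
  assumes tail: "\<And>n. N \<le> n \<Longrightarrow> cmod (diagonal n - b) \<le> h" "\<And>n. N \<le> n \<Longrightarrow> p \<le> cmod (lower n)"
      "\<And>n. N \<le> n \<Longrightarrow> cmod (upper n) \<le> q"
    and h: "0 < h" and q: "0 \<le> q" and gap: "q + 3 * h < p"
  shows "\<not> quasitriangular T"
proof
  assume qt: "quasitriangular T"
  note on = orthonormal_basisD[OF e]
  have p: "0 < p" using h q gap by linarith
  \<comment> \<open>\<open>up\<close> is injective and misses exactly \<open>N\<close>, the index
    where \<open>y\<close> will start. The entry from \<open>e N\<close> down to
    \<open>e (N - 1)\<close> is cut off by \<open>t N = 0\<close>, which decouples block and tail;
    \<open>t 0 = 0\<close> also makes the truncated \<open>n - 1\<close> harmless.\<close>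
  define s where "s n = (if n < N then complex_of_real p else lower n)" for n
  define t where "t n = (if n \<le> N then 0 else upper (n - 1))" for n
  define g where "g n = (if n < N then 0 else diagonal n - b)" for n
  define up where "up n = (if n < N then n else Suc n)" for n
  define w where "w n = s n *\<^sub>C e (up n) + t n *\<^sub>C e (n - 1) + g n *\<^sub>C e n" for n
  define v where "v n = T (e n) - b *\<^sub>C e n - w n" for n
  \<comment> \<open>Column \<open>N\<close> is corrected as well, since it contains the entry that
    was cut off.\<close>
  define A where "A x = T x - b *\<^sub>C x - (\<Sum>i\<le>N. cinner x (e i) *\<^sub>C v i)" for x
  have bA: "bounded_clinear A"
    unfolding A_def[abs_def] by (intro bounded_clinear_diff bounded_clinear_scaleC bounded_clinear_ident
        bounded_clinear_sum_fun bounded_clinear_rank_one T)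
  have Ae: "A (e n) = w n" for n
  proof (cases "n \<le> N")
    case True
    have "(\<Sum>i\<le>N. cinner (e n) (e i) *\<^sub>C v i) = (\<Sum>i\<le>N. if i = n then v i else 0)"
      by (intro sum.cong) (auto simp: on scaleC_one)
    also have "\<dots> = v n" using True by simp
    finally show ?thesis by (simp add: A_def v_def)
  next
    case False
    then obtain m where m: "n = Suc m" "N \<le> m" by (cases n) auto
    have "(\<Sum>i\<le>N. cinner (e n) (e i) *\<^sub>C v i) = 0"
      using False by (intro sum.neutral) (auto simp: on)
    then show ?thesis
      using m by (simp add: A_def T_Suc w_def s_def t_def g_def up_def complex_vec.scale_left_diff_distrib algebra_simps)
  qed
  have sp: "p \<le> cmod (s n)" for n using tail(2) p by (simp add: s_def)
  have tq: "cmod (t n) \<le> q" for n using tail(3) q by (simp add: t_def)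
  have gh: "cmod (g n) \<le> h" for n using tail(1) h by (simp add: g_def)
  have below: "(p - q - h) * norm x \<le> norm (A x)" for x
  proof -
    have "x \<in> {x. (p - q - h) * norm x \<le> norm (A x)}"
    proof (rule orthonormal_basis_closed_induct[OF e])
      show "closed {x. (p - q - h) * norm x \<le> norm (A x)}"
        by (intro closed_Collect_le continuous_intros linear_continuous_on bounded_clinearD(1)[OF bA])
      fix n and c :: "nat \<Rightarrow> complex"
      let ?x = "\<Sum>i<n. c i *\<^sub>C e i"
      let ?X1 = "\<Sum>i<n. (s i * c i) *\<^sub>C e (up i)"
      let ?X2 = "\<Sum>i\<in>{i. i < n \<and> N < i}. (t i * c i) *\<^sub>C e (i - 1)"
      let ?X3 = "\<Sum>i<n. (g i * c i) *\<^sub>C e i"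
      \<comment> \<open>Dropping the indices with zero weight makes i - 1 injective on the
        rest.\<close>
      have "?X2 = (\<Sum>i<n. (t i * c i) *\<^sub>C e (i - 1))"
        by (intro sum.mono_neutral_left) (auto simp: t_def)
      then have "A ?x = ?X1 + ?X2 + ?X3"
        by (simp add: bounded_clinear_sum[OF bA] bounded_clinearD(2)[OF bA] Ae w_def scaleC_add_right scaleC_scaleC
            sum.distrib mult.commute)
      then have "norm ?X1 \<le> norm (A ?x) + norm ?X2 + norm ?X3"
        using norm_triangle_ineq4[of "A ?x" "?X2 + ?X3"] norm_triangle_ineq[of ?X2 ?X3] by (simp add: algebra_simps)
      moreover have "p * norm ?x \<le> norm ?X1"
        using p sp by (intro orthonormal_norm_sum_ge[OF e]) (auto simp: inj_on_def up_def split: if_splits)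
      moreover have "norm ?X2 \<le> q * norm ?x"
        using q tq by (intro orthonormal_norm_sum_le[OF e]) (auto simp: inj_on_def)
      moreover have "norm ?X3 \<le> h * norm ?x"
        using h gh by (intro orthonormal_norm_sum_le[OF e, where p = "\<lambda>i. i"]) auto
      ultimately show "?x \<in> {x. (p - q - h) * norm x \<le> norm (A x)}"
        by (simp add: left_diff_distrib)
    qed
    then show ?thesis by simp
  qed
  have "q / p < 1" using p gap h by simp
  then have "(\<lambda>k. q * (q / p) ^ k) \<longlonglongrightarrow> q * 0"
    using p q by (intro tendsto_mult tendsto_const LIMSEQ_realpow_zero) auto
  then have "eventually (\<lambda>k. q * (q / p) ^ k < h) sequentially"
    using h by (intro order_tendstoD(2)) auto
  then obtain K where K: "q * (q / p) ^ K < h" by (auto simp: eventually_sequentially)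
  \<comment> \<open>The recursion solves the kernel equation of the adjoint of the off-diagonal part
    of the tail. It couples only indices of equal parity, and its solution decays like (q /
    p)^k.\<close>
  define Y where "Y = rec_nat 1 (\<lambda>k z. - z * cnj (upper (N + 2 * k)) / cnj (lower (N + 2 * k + 1)))"
  have Y0: "Y 0 = 1" and YS: "Y (Suc k) = - Y k * cnj (upper (N + 2 * k)) / cnj (lower (N + 2 * k + 1))" for k
    by (simp_all add: Y_def)
  have Y_le: "cmod (Y k) \<le> (q / p) ^ k" for k
  proof (induction k)
    case (Suc k)
    have "cmod (Y (Suc k)) = cmod (Y k) * (cmod (upper (N + 2 * k)) / cmod (lower (N + 2 * k + 1)))"
      by (simp add: YS norm_divide norm_mult)
    also have "\<dots> \<le> (q / p) ^ k * (q / p)"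
      using p q by (intro mult_mono Suc frac_le tail) auto
    finally show ?case by (simp add: mult.commute)
  qed (simp add: Y0)
  have YS': "lower (N + 2 * k + 1) * cnj (Y (Suc k)) + upper (N + 2 * k) * cnj (Y k) = 0" for k
  proof -
    have "lower (N + 2 * k + 1) \<noteq> 0" using tail(2)[of "N + 2 * k + 1"] p by auto
    then show ?thesis by (simp add: YS)
  qed
  define yc where "yc j = (if N \<le> j \<and> even (j - N) \<and> (j - N) div 2 \<le> K then Y ((j - N) div 2) else 0)" for j
  let ?m = "N + 2 * K + 2"
  define y where "y = (\<Sum>j<?m. yc j *\<^sub>C e j)"
  \<comment> \<open>This is the adjoint of \<open>A\<close> at \<open>y\<close>: the diagonal part,
    plus the one term left over by truncating at \<open>K\<close>.\<close>
  define z where "z = (\<Sum>j<?m. (cnj (g j) * yc j) *\<^sub>C e j) + (cnj (upper (N + 2 * K)) * Y K) *\<^sub>C e (N + 2 * K + 1)"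
  have coeff: "cinner (e n) (\<Sum>j<m. c j *\<^sub>C e j) = (if n < m then cnj (c n) else 0)" for n c m
    by (simp add: cinner_sum_right cinner_scaleC_right on if_distrib cong: if_cong)
  have yc0: "yc n = 0" if "\<not> n < ?m" for n using that by (auto simp: yc_def)
  have ye: "cinner (e n) y = cnj (yc n)" for n using yc0 unfolding y_def coeff by simp
  have ze: "cinner (e n) z = g n * cnj (yc n) + (if n = N + 2 * K + 1 then upper (N + 2 * K) * cnj (Y K) else 0)" for n
    using yc0[of n] unfolding z_def cinner_add_right coeff by (simp add: cinner_scaleC_right on)
  have yz: "cinner (w n) y = cinner (e n) z" for n
  proof -
    have "s n * cnj (yc (up n)) + t n * cnj (yc (n - 1)) =
        (if n = N + 2 * K + 1 then upper (N + 2 * K) * cnj (Y K) else 0)"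
    \<comment> \<open>\<open>y\<close> lives at even offsets from \<open>N\<close>, so its
      neighbours meet only at odd offsets, where \<open>YS'\<close> cancels them except at the
      truncation.\<close>
    proof (cases "N < n \<and> odd (n - N)")
      case True
      then obtain k where k: "n - N = 2 * k + 1" by (blast elim: oddE)
      then have n: "n = N + 2 * k + 1" using True by linarith
      have *: "yc (up n) = (if Suc k \<le> K then Y (Suc k) else 0)" "yc (n - 1) = (if k \<le> K then Y k else 0)"
        by (simp_all add: n up_def yc_def)
      show ?thesis
        unfolding * using YS'[of k] by (auto simp: n s_def t_def)
    next
      case False
      then have "yc (up n) = 0" by (auto simp: yc_def up_def Suc_diff_le)
      moreover have "t n * cnj (yc (n - 1)) = 0"
        using False by (auto simp: t_def yc_def)
      moreover have "n \<noteq> N + 2 * K + 1" using False by auto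
      ultimately show ?thesis by simp
    qed
    then show ?thesis by (simp add: w_def cinner_simps ye ze)
  qed
  have Ayz: "cinner (A x) y = cinner x z" for x
  proof -
    have "x \<in> {x. cinner (A x) y = cinner x z}"
    proof (rule orthonormal_basis_closed_induct[OF e])
      show "closed {x. cinner (A x) y = cinner x z}"
        by (intro closed_Collect_eq linear_continuous_on bounded_linear_cinner_left
            bounded_linear_compose[OF bounded_linear_cinner_left] bounded_clinearD(1)[OF bA])
      show "(\<Sum>i<n. c i *\<^sub>C e i) \<in> {x. cinner (A x) y = cinner x z}" for n :: nat and c
        by (simp add: bounded_clinear_sum[OF bA] bounded_clinearD(2)[OF bA] Ae cinner_sum_left cinner_scaleC_left yz)
    qed
    then show ?thesis by simp
  qed
  have "yc N = 1" by (simp add: yc_def Y0)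
  then have y1: "1 \<le> norm y"
    using cinner_norm_le[of "e N" y] by (simp add: ye on)
  have "norm z \<le> norm (\<Sum>j<?m. (cnj (g j) * yc j) *\<^sub>C e j) + norm ((cnj (upper (N + 2 * K)) * Y K) *\<^sub>C e (N + 2 * K + 1))"
    unfolding z_def by (rule norm_triangle_ineq)
  also have "\<dots> \<le> h * norm y + h * norm y"
  proof (rule add_mono)
    show "norm (\<Sum>j<?m. (cnj (g j) * yc j) *\<^sub>C e j) \<le> h * norm y"
      unfolding y_def using h gh by (intro orthonormal_norm_sum_le[OF e, where p = "\<lambda>i. i"]) auto
    have "norm ((cnj (upper (N + 2 * K)) * Y K) *\<^sub>C e (N + 2 * K + 1)) = cmod (upper (N + 2 * K)) * cmod (Y K)"
      by (simp add: norm_scaleC on norm_mult)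
    also have "\<dots> \<le> q * (q / p) ^ K" using q by (intro mult_mono tail Y_le) auto
    also have "\<dots> \<le> h * norm y" using K h y1 by (smt (verit) mult_le_cancel_left1)
    finally show "norm ((cnj (upper (N + 2 * K)) * Y K) *\<^sub>C e (N + 2 * K + 1)) \<le> h * norm y" .
  qed
  finally have nz: "norm z \<le> 2 * h * norm y" by simp
  have "y = 0"
  \<comment> \<open>The adjoint bound is 2 h (diagonal and truncation) and the lower bound is p - q
    - h; \<open>gap\<close> says exactly that the former is smaller.\<close>
  proof (rule quasitriangular_finite_rank_perturbation[OF T qt _ A_def below])
    show "cmod (cinner (A x) y) \<le> 2 * h * norm x * norm y" for x
    proof -
      have "cmod (cinner (A x) y) \<le> norm x * norm z" unfolding Ayz by (rule cinner_norm_le)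
      also have "\<dots> \<le> norm x * (2 * h * norm y)" using nz by (intro mult_left_mono) auto
      finally show ?thesis by (simp add: mult_ac)
    qed
  qed (use gap h in auto)
  then show False using y1 by simp
qed

end

lemma (in tridiagonal_hyponormal) quasitriangular_imp_normal:
  assumes "quasitriangular T"
  shows "normal_operator T"
proof (rule ccontr)
  assume "\<not> normal_operator T"
  then obtain b p q where lim: "diagonal \<longlonglongrightarrow> b" "(\<lambda>n. cmod (lower n)) \<longlonglongrightarrow> p" "(\<lambda>n. cmod (upper n)) \<longlonglongrightarrow> q"
    and pq: "q < p" "0 \<le> q"
    using entries_converge by blast
  \<comment> \<open>Replacing p by p - h and q by q + h, the required gap becomes 5 h < p -
    q.\<close>
  define h where "h = (p - q) / 6"
  have h: "0 < h" using pq by (simp add: h_def)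
  have "eventually (\<lambda>n. cmod (diagonal n - b) < h) sequentially"
    using lim(1) h by (simp add: tendsto_iff dist_norm)
  moreover have "eventually (\<lambda>n. p - h < cmod (lower n)) sequentially"
    using h by (intro order_tendstoD(1)[OF lim(2)]) simp
  moreover have "eventually (\<lambda>n. cmod (upper n) < q + h) sequentially"
    using h by (intro order_tendstoD(2)[OF lim(3)]) simp
  ultimately have "eventually (\<lambda>n. cmod (diagonal n - b) < h \<and> p - h < cmod (lower n) \<and> cmod (upper n) < q + h) sequentially"
    by eventually_elim blast
  then obtain N where N: "\<And>n. N \<le> n \<Longrightarrow>
      cmod (diagonal n - b) < h \<and> p - h < cmod (lower n) \<and> cmod (upper n) < q + h"
    by (auto simp: eventually_sequentially)
  have "\<not> quasitriangular T"
  proof (rule not_quasitriangular_if_lower_dominates)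
    show "cmod (diagonal n - b) \<le> h" "p - h \<le> cmod (lower n)" "cmod (upper n) \<le> q + h" if "N \<le> n" for n
      using N[OF that] by auto
    show "q + h + 3 * h < p - h" using pq by (simp add: h_def field_simps)
  qed (use h pq in auto)
  then show False using assms by contradiction
qed

theorem theorem2p3:
  fixes T :: "'a :: complex_hilbert_space \<Rightarrow> 'a" and e :: "nat \<Rightarrow> 'a"
  assumes "\<not> finite_cdim (UNIV :: 'a set)"
    and "separable_space (euclidean :: 'a topology)"
    and "bounded_clinear T"
    and "orthonormal_basis e"
    and "tridiagonal e T"
    and "hyponormal T"
  shows "normal_operator T \<longleftrightarrow> quasitriangular T"
proof
  assume "normal_operator T"
  then show "quasitriangular T" using assms(3,4) by (intro normal_imp_quasitriangular)
next
  interpret tridiagonal_hyponormal T e by unfold_locales fact+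
  assume "quasitriangular T"
  then show "normal_operator T" by (rule quasitriangular_imp_normal)
qed

end
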